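(* Let $f:\mathbb C\to\hat{\mathbb C}$ be a non-constant elliptic function. Then: (i) The Julia set $J(f)$ is not porous at a dense set of its points; in particular it is not porous at any point of the set $P_f:=\bigcup_{n=1}^\infty f^{-n}(\infty)$. (ii) For every $b\in P_f$ and every $\kappa\in(0,1)$ there exists $R(b,\kappa)>0$ such that $\operatorname{por}(J(f),b,r)\le\kappa$ for all $r\in(0,R(b,\kappa))$. (iii) If in addition $J(f)\ne\mathbb C$, then $J(f)$ is porous at a dense set of its points, namely at the repelling periodic points of $f$.
   Context: A meromorphic function $f:\mathbb C\to\hat{\mathbb C}$ is elliptic if it is doubly periodic: there are $w_1,w_2\in\mathbb C\setminus\{0\}$ with $\operatorname{Im}(w_2/w_1)\ne0$ and $f(z+w_1)=f(z+w_2)=f(z)$ for all $z\in\mathbb C$. The Fatou set $F(f)$ is the set of all $z\in\mathbb C$ having an open neighborhood $U_z$ on which all iterates $f^n$, $n\in\mathbb N$, are well defined and form a normal family in the sense of Montel. The Julia set is its complement, considered here in the plane: $J(f)=\mathbb C\setminus F(f)$. $f^{-n}(\infty)\subset\mathbb C$ is the set of points $z$ for which $f^n(z)$ is defined and equals $\infty$. Porosity is taken in $\mathbb C$ with the Euclidean metric: for $G\subset\mathbb C$, $x\in\mathbb C$, $r>0$, $\operatorname{por}(G,x,r)=\sup\{c\ge0: B(y,cr)\subset B(x,r)\setminus G\text{ for some }y\in\mathbb C\}$. $G$ is porous at $x$ if there are $c\in(0,1)$ and $r_0>0$ with $\operatorname{por}(G,x,r)\ge c$ for all $r\in(0,r_0)$.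 *)

theory Defs
  imports "HOL-Complex_Analysis.Complex_Analysis"
begin

text \<open>
  The Riemann sphere is \<^typ>\<open>complex option\<close>, with \<^const>\<open>None\<close> as the point at infinity.
  A meromorphic function on the plane is represented by a function that is
  \<^const>\<open>nicely_meromorphic_on\<close> the plane. Such a function has the dummy value 0 at its poles;
  \<open>sphere_map f\<close> is the actual map into the sphere.
\<close>

type_synonym sphere = "complex option"

definition sphere_map :: "(complex \<Rightarrow> complex) \<Rightarrow> complex \<Rightarrow> sphere" where
  "sphere_map f z = (if is_pole f z then None else Some (f z))"

definition elliptic :: "(complex \<Rightarrow> complex) \<Rightarrow> bool" where
  "elliptic f \<longleftrightarrow> f nicely_meromorphic_on UNIV \<and>
     (\<exists>w1 w2. w1 \<noteq> 0 \<and> w2 \<noteq> 0 \<and> Im (w2 / w1) \<noteq> 0 \<and>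
       (\<forall>z. sphere_map f (z + w1) = sphere_map f z \<and> sphere_map f (z + w2) = sphere_map f z))"

text \<open>
  The \<open>n\<close>-th iterate is defined at \<open>z\<close> if none of the earlier iterates sends \<open>z\<close> to infinity.
  Since \<open>iterate\<close> is total and also returns \<^const>\<open>None\<close> outside the domain of definition,
  \<open>iterate f n z = None\<close> means that the iterate takes the value infinity only in conjunction
  with \<open>iterate_defined f n z\<close>.
\<close>

primrec iterate :: "(complex \<Rightarrow> complex) \<Rightarrow> nat \<Rightarrow> complex \<Rightarrow> sphere" where
  "iterate f 0 z = Some z"
| "iterate f (Suc n) z = Option.bind (iterate f n z) (sphere_map f)"

definition iterate_defined :: "(complex \<Rightarrow> complex) \<Rightarrow> nat \<Rightarrow> complex \<Rightarrow> bool" where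
  "iterate_defined f n z \<longleftrightarrow> (\<forall>k<n. iterate f k z \<noteq> None)"

text \<open>
  The (inverse) stereographic projection onto the unit sphere of \<open>\<complex> \<times> \<real>\<close>, whose norm is
  Euclidean; the distance of the images of two points is their chordal distance.
\<close>

definition stereographic :: "sphere \<Rightarrow> complex \<times> real" where
  "stereographic x = (case x of
       None \<Rightarrow> (0, 1)
     | Some z \<Rightarrow> ((2 / (1 + (norm z)\<^sup>2)) *\<^sub>R z, ((norm z)\<^sup>2 - 1) / ((norm z)\<^sup>2 + 1)))"

text \<open>
  Normality in the sense of Montel: every sequence in the family has a subsequence converging
  in the chordal metric, uniformly on compact subsets. The limit is allowed to take the value
  infinity.
\<close>

definition normal_family_on :: "(complex \<Rightarrow> sphere) set \<Rightarrow> complex set \<Rightarrow> bool" where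
  "normal_family_on \<F> U \<longleftrightarrow>
     (\<forall>s. range s \<subseteq> \<F> \<longrightarrow>
       (\<exists>(r :: nat \<Rightarrow> nat) g. strict_mono r \<and>
         (\<forall>K. compact K \<and> K \<subseteq> U \<longrightarrow>
           uniform_limit K (\<lambda>n z. stereographic (s (r n) z)) (\<lambda>z. stereographic (g z))
             sequentially)))"

definition fatou_set :: "(complex \<Rightarrow> complex) \<Rightarrow> complex set" where
  "fatou_set f = {z. \<exists>U. open U \<and> z \<in> U \<and>
     (\<forall>n\<ge>1. \<forall>w\<in>U. iterate_defined f n w) \<and>
     normal_family_on {iterate f n |n. n \<ge> 1} U}"

definition julia_set :: "(complex \<Rightarrow> complex) \<Rightarrow> complex set" where
  "julia_set f = - fatou_set f"

definition prepoles :: "(complex \<Rightarrow> complex) \<Rightarrow> complex set" where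
  "prepoles f = (\<Union>n\<in>{1..}. {z. iterate_defined f n z \<and> iterate f n z = None})"

text \<open>
  If \<open>iterate f n z\<close> is finite, then so is \<open>iterate f n w\<close> for all \<open>w\<close> near \<open>z\<close>, so the
  derivative of \<open>the (iterate f n w)\<close> at \<open>z\<close> below is that of a holomorphic function.
\<close>

definition repelling_periodic_points :: "(complex \<Rightarrow> complex) \<Rightarrow> complex set" where
  "repelling_periodic_points f =
     {z. \<exists>n\<ge>1. iterate_defined f n z \<and> iterate f n z = Some z \<and>
       norm (deriv (\<lambda>w. the (iterate f n w)) z) > 1}"

text \<open>For \<open>r > 0\<close> the set below contains 0 and is bounded above by 1.\<close>

definition por :: "complex set \<Rightarrow> complex \<Rightarrow> real \<Rightarrow> real" where
  "por G x r = Sup {c. c \<ge> 0 \<and> (\<exists>y. ball y (c * r) \<subseteq> ball x r - G)}"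

definition porous_at :: "complex set \<Rightarrow> complex \<Rightarrow> bool" where
  "porous_at G x \<longleftrightarrow> (\<exists>c\<in>{0<..<1}. \<exists>r0>0. \<forall>r\<in>{0<..<r0}. por G x r \<ge> c)"

definition dense_subset_of :: "complex set \<Rightarrow> complex set \<Rightarrow> bool" where
  "dense_subset_of D A \<longleftrightarrow> D \<subseteq> A \<and> A \<subseteq> closure D"

end

theory Submission
  imports Defs
begin

text \<open>
  Poles are relatively dense in the plane, so by Bloch's theorem iterates have locally bounded
  derivatives off the closure of the prepoles, and the Julia set equals that closure. At a
  pole \<open>b\<close> of an iterate \<open>F\<close> the product \<open>(z - b) F'(z)\<close> tends to infinity, hence \<open>F\<close> maps a ball
  of radius \<open>\<kappa> r\<close> in \<open>B(b, r)\<close> onto a set containing a disc so large that it meets the poles.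
  Repelling points near a prepole \<open>b = f a\<close> with \<open>f' a \<noteq> 0\<close>: if \<open>g\<close> is the local inverse of \<open>f\<close> with
  \<open>g b = a\<close>, then \<open>F - g\<close> has a pole at \<open>b\<close> and so attains a period \<open>\<omega>\<close> close to \<open>b\<close>; at such a \<open>z\<close>
  we get \<open>f (F z) = f (g z + \<omega>) = z\<close>, with multiplier \<open>F'(z) / g'(z)\<close>. Finally, a Julia set that is not
  the whole plane has empty interior, and the inverse branch at a repelling point copies a ball of
  its complement to all scales.
\<close>

section \<open>Poles and lattices\<close>

text \<open>With \<open>F = g / (z - b) ^ q\<close> and \<open>g b \<noteq> 0\<close>, the product
  is \<open>F\<close> times a factor tending to \<open>- q\<close>, so it inherits the pole.
  Divergence of the product, and not only of \<open>deriv F\<close>, is what later gives the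
  porosity bound for every \<open>\<kappa>\<close>.\<close>

lemma is_pole_linear_times_deriv:
  assumes "is_pole F b" "isolated_singularity_at F b"
  shows "is_pole (\<lambda>z. (z - b) * deriv F z) b"
proof -
  obtain r where r: "r > 0" "F analytic_on ball b r - {b}"
    using assms(2) by (auto simp: isolated_singularity_at_def)
  define q where "q = nat (- zorder F b)"
  define g where "g = zor_poly F b"
  have "F holomorphic_on ball b r - {b}" using r(2) analytic_imp_holomorphic by blast
  from zorder_exist_pole[OF this open_ball _ assms(1)] r(1)
  obtain s where q: "q > 0" and gb: "g b \<noteq> 0" and s: "s > 0" "g holomorphic_on cball b s"
      "\<And>w. w \<in> cball b s - {b} \<Longrightarrow> F w = g w / (w - b) ^ q \<and> g w \<noteq> 0"
    by (auto simp: q_def g_def)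
  have holg: "g holomorphic_on ball b s" using s(2) by (rule holomorphic_on_subset) auto
  have dF: "(z - b) * deriv F z = ((z - b) * deriv g z / g z - of_nat q) * F z"
    if z: "z \<in> ball b s - {b}" for z
  proof -
    have "(g has_field_derivative deriv g z) (at z)"
      using holg z by (intro holomorphic_derivI[of g "ball b s"]) auto
    then have D: "((\<lambda>w. g w / (w - b) ^ q) has_field_derivative
        (deriv g z * (z - b) ^ q - g z * (of_nat q * (z - b) ^ (q - 1))) / ((z - b) ^ q * (z - b) ^ q)) (at z)"
      using z by (auto intro!: derivative_eq_intros)
    have "(F has_field_derivative
        (deriv g z * (z - b) ^ q - g z * (of_nat q * (z - b) ^ (q - 1))) / ((z - b) ^ q * (z - b) ^ q)) (at z)"
      by (rule has_field_derivative_transform_within_open[OF D, of "ball b s - {b}"])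
         (use z s in \<open>auto simp: open_Diff\<close>)
    then have "deriv F z = (deriv g z * (z - b) ^ q - g z * (of_nat q * (z - b) ^ (q - 1))) / ((z - b) ^ q * (z - b) ^ q)"
      by (rule DERIV_imp_deriv)
    moreover have "F z = g z / (z - b) ^ q" "g z \<noteq> 0" using s(3)[of z] z by auto
    moreover have "(z - b) ^ q = (z - b) * (z - b) ^ (q - 1)"
      using q by (metis Suc_diff_1 power_Suc)
    \<comment> \<open>The quotient rule in abstract form, with \<open>c\<close> for
      \<open>z - b\<close>, \<open>p\<close> for \<open>(z - b) ^ (q - 1)\<close> and
      \<open>d\<close> for \<open>deriv g z\<close>.\<close>
    moreover have "c * ((d * (c * p) - g z * (of_nat q * p)) / ((c * p) * (c * p)))
        = (c * d / g z - of_nat q) * (g z / (c * p))" if "c \<noteq> 0" "p \<noteq> 0" for c d p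
      using that \<open>g z \<noteq> 0\<close> by (simp add: field_simps)
    ultimately show ?thesis using z by simp
  qed
  have "b \<in> ball b s" using s(1) by simp
  then have "isCont g b" "isCont (deriv g) b"
    using holg holomorphic_deriv[OF holg open_ball]
    by (auto simp: continuous_on_eq_continuous_at dest!: holomorphic_on_imp_continuous_on)
  then have "((\<lambda>z. (z - b) * deriv g z / g z - of_nat q) \<longlongrightarrow> (b - b) * deriv g b / g b - of_nat q) (at b)"
    using gb by (intro tendsto_intros) (auto simp: isCont_def)
  then have "filterlim (\<lambda>z. ((z - b) * deriv g z / g z - of_nat q) * F z) at_infinity (at b)"
    by (rule tendsto_mult_filterlim_at_infinity) (use q assms(1) in \<open>auto simp: is_pole_def\<close>)
  moreover have "\<forall>\<^sub>F z in at b. ((z - b) * deriv g z / g z - of_nat q) * F z = (z - b) * deriv F z"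
    using dF s(1) by (auto simp: eventually_at dist_commute intro!: exI[of _ s])
  ultimately show ?thesis unfolding is_pole_def
    using filterlim_cong[OF refl refl] by fast
qed

text \<open>The reciprocal of \<open>F\<close> extends holomorphically with a zero at
  \<open>b\<close>. By the open mapping theorem its image contains a disc about 0, and the
  reciprocals of that disc form a neighbourhood of infinity.\<close>

lemma pole_covers_near_infinity:
  assumes pole: "is_pole F b" and iso: "isolated_singularity_at F b" and U: "open U" "b \<in> U"
  obtains R where "\<And>v. norm v > R \<Longrightarrow> \<exists>z\<in>U - {b}. F z = v"
proof -
  have "eventually (\<lambda>w. F w \<noteq> 0 \<and> w \<in> U) (at b)"
    using non_zero_neighbour_pole[OF pole] eventually_at_in_open'[OF U] by (rule eventually_conj)
  then obtain r1 where r1: "r1 > 0" "\<And>w. w \<in> ball b r1 - {b} \<Longrightarrow> F w \<noteq> 0 \<and> w \<in> U"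
    by (auto simp: eventually_at dist_commute)
  obtain r2 where r2: "r2 > 0" "F analytic_on ball b r2 - {b}"
    using iso by (auto simp: isolated_singularity_at_def)
  define B where "B = ball b (min r1 r2)"
  have B: "open B" "connected B" "b \<in> B" "B \<subseteq> ball b r1" "B \<subseteq> ball b r2"
    using r1 r2 by (auto simp: B_def)
  define h where "h = (\<lambda>z. if z = b then 0 else inverse (F z))"
  have holF: "F holomorphic_on B - {b}"
    using r2(2) B(5) by (meson Diff_mono analytic_imp_holomorphic holomorphic_on_subset order_refl)
  have holh: "h holomorphic_on B"
    unfolding h_def using is_pole_inverse_holomorphic[OF B(1) holF pole] r1 B(4) by blast
  \<comment> \<open>A point of \<open>B\<close> other than \<open>b\<close>: \<open>h\<close> is
    nonzero there, so \<open>h\<close> is not constant.\<close>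
  obtain e where e: "e > 0" "e < min r1 r2" using r1 r2 by (meson field_lbound_gt_zero min_less_iff_conj)
  have "b + of_real e \<in> B - {b}" using e by (auto simp: B_def dist_norm)
  then have "h (b + of_real e) \<noteq> h b" using r1(2) B(4) by (auto simp: h_def)
  then have "\<not> h constant_on B"
    using \<open>b + of_real e \<in> B - {b}\<close> B(3) unfolding constant_on_def by force
  then have "open (h ` B)" using open_mapping_thm[OF holh B(1,2) B(1)] by auto
  moreover have "0 \<in> h ` B" using B(3) by (auto simp: h_def image_iff intro!: bexI[of _ b])
  ultimately obtain d where d: "d > 0" "ball 0 d \<subseteq> h ` B" using openE by blast
  show thesis
  proof
    fix v :: complex assume v: "norm v > 1 / d"
    have "v \<noteq> 0" using v d by auto
    then have "norm (inverse v) < d" using v d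
    by (simp add: norm_inverse norm_divide divide_less_eq mult.commute flip: divide_inverse)
       (simp add: inverse_eq_divide divide_less_eq mult.commute)
    then obtain z where z: "z \<in> B" "inverse v = h z" using d(2) by (auto simp: subset_iff)
    then have "z \<noteq> b" using \<open>v \<noteq> 0\<close> by (auto simp: h_def)
    then have "F z = v" using z by (simp add: h_def)
    then show "\<exists>z\<in>U - {b}. F z = v" using z r1(2) B(4) \<open>z \<noteq> b\<close> by blast
  qed
qed

text \<open>Rounding down the real coordinates of \<open>z\<close> in the basis \<open>w1\<close>,
  \<open>w2\<close> leaves a remainder in the fundamental parallelogram, of norm at most
  \<open>norm w1 + norm w2\<close>.\<close>

lemma lattice_relatively_dense:
  fixes w1 w2 :: complex
  assumes "w1 \<noteq> 0" "Im (w2 / w1) \<noteq> 0"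
  obtains D where "\<And>z. \<exists>m n. norm (z - (of_int m * w1 + of_int n * w2)) \<le> D"
proof
  fix z
  define t where "t = w2 / w1"
  have "Im t \<noteq> 0" using assms(2) by (simp add: t_def)
  define y where "y = Im (z / w1) / Im t"
  define x where "x = Re (z / w1) - y * Re t"
  have "z / w1 = of_real x + of_real y * t"
    using \<open>Im t \<noteq> 0\<close> by (simp add: complex_eq_iff x_def y_def)
  then have "z = of_real x * w1 + of_real y * w2"
    using assms(1) by (simp add: field_simps t_def)
  then have "norm (z - (of_int \<lfloor>x\<rfloor> * w1 + of_int \<lfloor>y\<rfloor> * w2)) = norm (of_real (frac x) * w1 + of_real (frac y) * w2)"
    by (simp add: frac_def algebra_simps)
  also have "norm (of_real (frac x) * w1 + of_real (frac y) * w2) \<le> frac x * norm w1 + frac y * norm w2"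
    by (rule norm_triangle_le) (simp add: norm_mult)
  also have "\<dots> \<le> norm w1 + norm w2"
    by (intro add_mono mult_left_le_one_le) (auto simp: less_imp_le frac_lt_1)
  finally show "\<exists>m n. norm (z - (of_int m * w1 + of_int n * w2)) \<le> norm w1 + norm w2"
    by blast
qed

text \<open>Phrased with \<open>sphere_map\<close>, so that a period also preserves the set of
  poles, where \<open>f\<close> itself has only a dummy value.\<close>

definition periods :: "(complex \<Rightarrow> complex) \<Rightarrow> complex set" where
  "periods f = {w. \<forall>z. sphere_map f (z + w) = sphere_map f z}"

lemma periods_add: "v \<in> periods f \<Longrightarrow> w \<in> periods f \<Longrightarrow> v + w \<in> periods f"
  by (simp add: periods_def flip: add.assoc)

lemma periods_minus:
  assumes "w \<in> periods f"
  shows "- w \<in> periods f"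
proof -
  have "sphere_map f (z - w + w) = sphere_map f (z - w)" for z
    using assms unfolding periods_def by blast
  then show ?thesis by (simp add: periods_def)
qed

lemma periods_of_int_mult:
  assumes "w \<in> periods f"
  shows "of_int m * w \<in> periods f"
proof -
  have *: "of_nat n * w \<in> periods f" for n
  proof (induction n)
    case 0
    show ?case by (simp add: periods_def)
  next
    case (Suc n)
    show ?case using periods_add[OF assms Suc] by (simp add: distrib_right)
  qed
  show ?thesis
  proof (cases "m \<ge> 0")
    case True
    then show ?thesis using *[of "nat m"] by simp
  next
    case False
    then show ?thesis using periods_minus[OF *[of "nat (-m)"]] by simp
  qed
qed

lemma nicely_meromorphic_not_pole_iff:
  assumes "f nicely_meromorphic_on UNIV"
  shows "\<not> is_pole f z \<longleftrightarrow> f analytic_on {z}"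
  using assms analytic_at_imp_no_pole nicely_meromorphic_on_imp_analytic_at[OF assms] by blast

section \<open>Stereographic projection\<close>

lemma inner_stereographic:
  "stereographic (Some z) \<bullet> stereographic (Some w) =
     (4 * (z \<bullet> w) + ((norm z)\<^sup>2 - 1) * ((norm w)\<^sup>2 - 1)) / ((1 + (norm z)\<^sup>2) * (1 + (norm w)\<^sup>2))"
  by (simp add: stereographic_def add_divide_distrib add.commute)

lemma norm_stereographic: "norm (stereographic x) = 1"
proof (cases x)
  case (Some z)
  define a where "a = (norm z)\<^sup>2"
  have "1 + a > 0" by (simp add: a_def add_pos_nonneg)
  moreover have "stereographic x \<bullet> stereographic x = (4 * a + (a - 1) * (a - 1)) / ((1 + a) * (1 + a))"
    unfolding Some inner_stereographic a_def by (simp add: dot_square_norm)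
  moreover have "4 * a + (a - 1) * (a - 1) = (1 + a) * (1 + a)" by (simp add: algebra_simps)
  ultimately show ?thesis by (simp add: norm_eq_sqrt_inner)
qed (simp add: stereographic_def norm_Pair)

text \<open>The squared chordal distance is \<open>4 * (norm (z - w))\<^sup>2\<close> divided by
  \<open>(1 + (norm z)\<^sup>2) * (1 + (norm w)\<^sup>2)\<close>, and this denominator is at least
  1.\<close>

lemma stereographic_lipschitz:
  "norm (stereographic (Some z) - stereographic (Some w)) \<le> 2 * norm (z - w)"
proof (rule power2_le_imp_le)
  define a b c where "a = (norm z)\<^sup>2" and "b = (norm w)\<^sup>2" and "c = z \<bullet> w"
  have pos: "1 + a \<ge> 1" "1 + b \<ge> 1" by (auto simp: a_def b_def)
  have zw: "(norm (z - w))\<^sup>2 = a + b - 2 * c"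
    by (simp add: a_def b_def c_def power2_norm_eq_inner inner_diff_left inner_diff_right inner_commute)
  have "(norm (stereographic (Some z) - stereographic (Some w)))\<^sup>2
      = (norm (stereographic (Some z)))\<^sup>2 + (norm (stereographic (Some w)))\<^sup>2
        - 2 * (stereographic (Some z) \<bullet> stereographic (Some w))"
    by (simp add: power2_norm_eq_inner inner_diff_left inner_diff_right inner_commute)
  also have "\<dots> = 2 - 2 * ((4 * c + (a - 1) * (b - 1)) / ((1 + a) * (1 + b)))"
    by (simp add: norm_stereographic inner_stereographic a_def b_def c_def)
  also have "\<dots> = 4 * (a + b - 2 * c) / ((1 + a) * (1 + b))"
  proof -
    have *: "2 - 2 * (x / d) = y / d" if "d \<noteq> 0" "2 * d - 2 * x = y" for x y d :: real
      using that by (simp add: field_simps)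
    show ?thesis
    proof (rule *)
      show "(1 + a) * (1 + b) \<noteq> 0" using pos by simp
    qed (simp add: algebra_simps)
  qed
  also have "\<dots> \<le> 4 * (a + b - 2 * c) / 1"
    using pos zw mult_mono[OF pos] by (intro divide_left_mono) (auto simp flip: zw)
  finally show "(norm (stereographic (Some z) - stereographic (Some w)))\<^sup>2 \<le> (2 * norm (z - w))\<^sup>2"
    by (simp add: power_mult_distrib zw)
qed simp

text \<open>Projection from the north pole inverts the map: \<open>(\<zeta>, t)\<close> comes from
  \<open>\<zeta> / (1 - t)\<close> if \<open>t \<noteq> 1\<close>, and from infinity
  otherwise.\<close>

lemma unit_sphere_eq_range_stereographic:
  assumes "norm p = 1"
  shows "p \<in> range stereographic"
proof -
  obtain \<zeta> t where p: "p = (\<zeta>, t)" by (cases p)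
  have nz: "(norm \<zeta>)\<^sup>2 = (1 - t) * (1 + t)"
    using assms by (simp add: p norm_Pair real_sqrt_eq_1_iff power2_eq_square algebra_simps)
  show ?thesis
  proof (cases "t = 1")
    case True
    then have "stereographic None = p" using nz by (simp add: p stereographic_def)
    then show ?thesis by blast
  next
    case False
    define z where "z = inverse (1 - t) *\<^sub>R \<zeta>"
    have "(norm z)\<^sup>2 = (norm \<zeta>)\<^sup>2 / (1 - t)\<^sup>2"
      by (simp add: z_def power_mult_distrib power_inverse divide_inverse)
    also have "\<dots> = (1 + t) / (1 - t)"
      using False unfolding nz by (simp add: power2_eq_square)
    finally have z: "(norm z)\<^sup>2 = (1 + t) / (1 - t)" .
    have "1 + (norm z)\<^sup>2 = 2 / (1 - t)" "(norm z)\<^sup>2 - 1 = 2 * t / (1 - t)"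
      using False unfolding z by (auto simp: field_simps)
    moreover have "(1 - t) *\<^sub>R z = \<zeta>" using False by (simp add: z_def)
    ultimately have "stereographic (Some z) = p"
      using False by (simp add: stereographic_def p add.commute diff_divide_distrib)
    then show ?thesis by blast
  qed
qed

section \<open>Porosity\<close>

text \<open>A hole of larger ratio could be shrunk about its own centre to one of ratio exactly
  \<open>\<kappa>\<close>.\<close>

lemma por_le:
  assumes "r > 0" "\<kappa> \<ge> 0" and no: "\<And>y. \<not> ball y (\<kappa> * r) \<subseteq> ball x r - G"
  shows "por G x r \<le> \<kappa>"
  unfolding por_def
proof (rule cSup_least)
  fix c assume "c \<in> {c. c \<ge> 0 \<and> (\<exists>y. ball y (c * r) \<subseteq> ball x r - G)}"
  then obtain y where y: "ball y (c * r) \<subseteq> ball x r - G" by blast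
  show "c \<le> \<kappa>"
  proof (rule ccontr)
    assume "\<not> c \<le> \<kappa>"
    then have "\<kappa> * r \<le> c * r" using assms(1) by simp
    then have "ball y (\<kappa> * r) \<subseteq> ball x r - G" using y subset_ball by blast
    then show False using no by blast
  qed
qed (auto intro!: exI[of _ 0])

lemma le_por:
  assumes "r > 0" "c \<ge> 0" "ball y (c * r) \<subseteq> ball x r - G"
  shows "c \<le> por G x r"
  unfolding por_def
proof (rule cSup_upper)
  show "bdd_above {c. c \<ge> 0 \<and> (\<exists>y. ball y (c * r) \<subseteq> ball x r - G)}"
  proof (rule bdd_aboveI[of _ 1])
    fix c assume "c \<in> {c. c \<ge> 0 \<and> (\<exists>y. ball y (c * r) \<subseteq> ball x r - G)}"
    then obtain y where "ball y (c * r) \<subseteq> ball x r" by blast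
    \<comment> \<open>The second alternative is the empty ball.\<close>
    then have "dist y x + c * r \<le> r \<or> c * r \<le> 0" by (simp add: ball_subset_ball_iff)
    then have "c * r \<le> 1 * r" using assms(1) zero_le_dist[of y x] by linarith
    then show "c \<le> 1" using assms(1) by (simp only: mult_le_cancel_right_pos)
  qed
qed (use assms in auto)

section \<open>Iteration near an attracting fixed point\<close>

lemma exp_neg_double_le_one_minus:
  fixes y :: real
  assumes "0 \<le> y" "y \<le> 1 / 2"
  shows "exp (- 2 * y) \<le> 1 - y"
proof -
  have "y\<^sup>2 \<le> y * (1 / 2)" unfolding power2_eq_square using assms by (intro mult_left_mono) auto
  then have "- 2 * y \<le> ln (1 - y)" using ln_one_minus_pos_lower_bound[OF assms] by simp
  then show ?thesis using assms by (simp add: ln_ge_iff)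
qed

text \<open>Near \<open>z\<close> the second derivative is bounded by some \<open>B\<close>, so
  \<open>deriv g\<close> varies by at most \<open>B * norm (w - z)\<close>. Setting
  \<open>A = B / \<mu>\<close> turns this into relative errors, whose product along an orbit can be
  controlled.\<close>

lemma attracting_fixpoint_contraction:
  fixes g :: "complex \<Rightarrow> complex"
  assumes hol: "g holomorphic_on T" and T: "open T" "z \<in> T" and fp: "g z = z"
    and \<mu>: "norm (deriv g z) = \<mu>" "0 < \<mu>" "\<mu> < 1"
  obtains A \<rho> where "A > 0" "\<rho> > 0" "A * \<rho> \<le> (1 - \<mu>) / 2" "ball z \<rho> \<subseteq> T"
    "\<And>w. w \<in> ball z \<rho> \<Longrightarrow> norm (g w - z) \<le> \<mu> * (1 + A * norm (w - z)) * norm (w - z)"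
    "\<And>w. w \<in> ball z \<rho> \<Longrightarrow> norm (deriv g w) \<ge> \<mu> * (1 - A * norm (w - z))"
proof -
  obtain \<rho>1 where \<rho>1: "\<rho>1 > 0" "cball z \<rho>1 \<subseteq> T" using T open_contains_cball by blast
  have hol1: "deriv g holomorphic_on T" and hol2: "deriv (deriv g) holomorphic_on T"
    using hol T(1) by (auto intro: holomorphic_deriv)
  have "compact (deriv (deriv g) ` cball z \<rho>1)"
    using hol2 \<rho>1(2) by (intro compact_continuous_image)
      (auto intro: holomorphic_on_imp_continuous_on holomorphic_on_subset)
  then obtain B where B: "B > 0" "\<And>w. w \<in> cball z \<rho>1 \<Longrightarrow> norm (deriv (deriv g) w) \<le> B"
    using compact_imp_bounded bounded_pos by (metis imageI)
  have dg: "norm (deriv g w - deriv g z) \<le> B * norm (w - z)" if w: "w \<in> cball z \<rho>1" for w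
  proof (rule field_differentiable_bound[OF convex_cball])
    fix u assume "u \<in> cball z \<rho>1"
    then have "u \<in> T" using \<rho>1(2) by blast
    then show "(deriv g has_field_derivative deriv (deriv g) u) (at u within cball z \<rho>1)"
      using holomorphic_derivI[OF hol1 T(1)] has_field_derivative_at_within by blast
  qed (use B w \<rho>1 in auto)
  define A where "A = B / \<mu>"
  have A: "A > 0" "B = \<mu> * A" using B(1) \<mu> by (auto simp: A_def)
  \<comment> \<open>The bound on \<open>A * \<rho>\<close> obtained from this choice keeps the
    contraction rate below 1 and makes the errors along an orbit sum to at most 1.\<close>
  define \<rho> where "\<rho> = min \<rho>1 ((1 - \<mu>) / (2 * A))"
  have "\<rho> > 0" using \<rho>1 \<mu> A by (simp add: \<rho>_def)
  moreover have "A * \<rho> \<le> A * ((1 - \<mu>) / (2 * A))"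
    using A(1) by (intro mult_left_mono) (auto simp: \<rho>_def)
  then have "A * \<rho> \<le> (1 - \<mu>) / 2" using A(1) by simp
  moreover have in1: "w \<in> cball z \<rho>1" if "w \<in> ball z \<rho>" for w using that by (auto simp: \<rho>_def)
  then have "ball z \<rho> \<subseteq> T" using \<rho>1(2) by blast
  moreover have "norm (g w - z) \<le> \<mu> * (1 + A * norm (w - z)) * norm (w - z)" if w: "w \<in> ball z \<rho>" for w
  proof -
    \<comment> \<open>The mean value inequality is used on the disc whose boundary passes through
      \<open>w\<close>, so that the error involves \<open>norm (w - z)\<close> itself.\<close>
    have "norm (g w - g z) \<le> \<mu> * (1 + A * norm (w - z)) * norm (w - z)"
    proof (rule field_differentiable_bound[OF convex_cball[of z "norm (w - z)"]])
      fix u assume u: "u \<in> cball z (norm (w - z))"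
      then have u1: "u \<in> cball z \<rho>1" using in1[OF w] by (auto simp: dist_norm norm_minus_commute)
      then have "u \<in> T" using \<rho>1(2) by blast
      then show "(g has_field_derivative deriv g u) (at u within cball z (norm (w - z)))"
        using holomorphic_derivI[OF hol T(1)] has_field_derivative_at_within by blast
      have "norm (deriv g u) \<le> norm (deriv g z) + norm (deriv g u - deriv g z)"
        using norm_triangle_sub by blast
      also have "\<dots> \<le> \<mu> + B * norm (w - z)"
      proof -
        have "B * norm (u - z) \<le> B * norm (w - z)"
          using u B(1) by (intro mult_left_mono) (auto simp: dist_norm norm_minus_commute)
        then show ?thesis using dg[OF u1] \<mu>(1) by simp
      qed
      finally show "norm (deriv g u) \<le> \<mu> * (1 + A * norm (w - z))"
        by (simp add: A(2) algebra_simps)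
    qed (auto simp: dist_norm norm_minus_commute)
    then show ?thesis using fp by simp
  qed
  moreover have "norm (deriv g w) \<ge> \<mu> * (1 - A * norm (w - z))" if w: "w \<in> ball z \<rho>" for w
  proof -
    have "norm (deriv g z) \<le> norm (deriv g w) + norm (deriv g w - deriv g z)"
      using norm_triangle_sub[of "deriv g z" "deriv g w"] by (simp add: norm_minus_commute)
    then show ?thesis using dg[OF in1[OF w]] \<mu>(1) by (simp add: A(2) algebra_simps)
  qed
  ultimately show thesis using that A(1) by blast
qed

text \<open>
  Orbits converge to the fixed point geometrically, so the multiplicative errors accumulated
  along an orbit form a convergent product; the radius is chosen so small that the sum of the
  errors is at most 1.
\<close>

lemma attracting_fixpoint_bounded_distortion:
  fixes g :: "complex \<Rightarrow> complex"
  assumes hol: "g holomorphic_on T" and T: "open T" "z \<in> T" and fp: "g z = z"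
    and \<mu>: "norm (deriv g z) = \<mu>" "0 < \<mu>" "\<mu> < 1"
  obtains \<rho> where "\<rho> > 0" "ball z \<rho> \<subseteq> T"
    "\<And>k. (g ^^ k) holomorphic_on ball z \<rho>"
    "\<And>k w. w \<in> ball z \<rho> \<Longrightarrow> (g ^^ k) w \<in> ball z \<rho>"
    "\<And>k w. w \<in> ball z \<rho> \<Longrightarrow> norm ((g ^^ k) w - z) < \<rho> * exp 1 * \<mu> ^ k"
    "\<And>k w. w \<in> ball z \<rho> \<Longrightarrow> norm (deriv (g ^^ k) w) \<ge> exp (- 2) * \<mu> ^ k"
proof -
  obtain A \<rho> where A: "A > 0" and \<rho>: "\<rho> > 0" "A * \<rho> \<le> (1 - \<mu>) / 2" "ball z \<rho> \<subseteq> T"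
    and le: "\<And>w. w \<in> ball z \<rho> \<Longrightarrow> norm (g w - z) \<le> \<mu> * (1 + A * norm (w - z)) * norm (w - z)"
    and ge: "\<And>w. w \<in> ball z \<rho> \<Longrightarrow> norm (deriv g w) \<ge> \<mu> * (1 - A * norm (w - z))"
    using attracting_fixpoint_contraction[OF assms] by blast
  \<comment> \<open>This cruder rate between \<open>\<mu>\<close> and 1 keeps orbits in the disc and
    makes the errors summable; the sharp rate \<open>\<mu>\<close> is recovered in \<open>up\<close>
    and \<open>low\<close>.\<close>
  define \<theta> where "\<theta> = (1 + \<mu>) / 2"
  have \<theta>: "0 < \<theta>" "\<theta> < 1" using \<mu> by (auto simp: \<theta>_def)
  have step: "norm (g w - z) \<le> \<theta> * norm (w - z)" if w: "w \<in> ball z \<rho>" for w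
  proof -
    have "A * norm (w - z) \<le> A * \<rho>"
      using w A by (intro mult_left_mono) (auto simp: dist_norm norm_minus_commute)
    then have "A * norm (w - z) \<le> (1 - \<mu>) / 2" using \<rho>(2) by simp
    moreover have "\<mu> * (A * norm (w - z)) \<le> A * norm (w - z)"
      using \<mu> A by (intro mult_left_le_one_le) auto
    ultimately have "\<mu> * (1 + A * norm (w - z)) \<le> \<theta>"
      by (simp add: \<theta>_def field_simps)
    then show ?thesis using le[OF w] mult_right_mono[OF _ norm_ge_zero[of "w - z"]] by fastforce
  qed
  have into: "g w \<in> ball z \<rho>" if w: "w \<in> ball z \<rho>" for w
  proof -
    have "\<theta> * norm (w - z) \<le> norm (w - z)" using \<theta> by (intro mult_left_le_one_le) auto
    then show ?thesis using step[OF w] w by (auto simp: dist_norm norm_minus_commute)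
  qed
  have orbit: "(g ^^ k) w \<in> ball z \<rho>" if "w \<in> ball z \<rho>" for k w
    by (induction k) (use that into in auto)
  have holk: "(g ^^ k) holomorphic_on ball z \<rho>" for k
  proof (induction k)
    case (Suc k)
    have "g \<circ> (g ^^ k) holomorphic_on ball z \<rho>"
      by (rule holomorphic_on_compose_gen[OF Suc hol]) (use orbit \<rho>(3) in blast)
    then show ?case by (simp add: o_def)
  qed (auto simp: id_def)
  \<comment> \<open>The accumulated error in the exponent: a geometric sum below
    \<open>A * \<rho> / (1 - \<theta>)\<close>, which is at most 1 since
    \<open>1 - \<theta> = (1 - \<mu>) / 2\<close>.\<close>
  define S where "S k = (\<Sum>j<k. A * \<rho> * \<theta> ^ j)" for k
  have S: "S k \<le> 1" for k
  proof -
    have "S k = A * \<rho> * ((1 - \<theta> ^ k) / (1 - \<theta>))"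
      using \<theta> by (simp add: S_def sum_gp_strict flip: sum_distrib_left)
    also have "\<dots> \<le> A * \<rho> * (1 / (1 - \<theta>))"
      using A \<rho> \<theta> by (intro mult_left_mono divide_right_mono) auto
    also have "\<dots> \<le> 1" using \<rho>(2) \<theta> by (simp add: \<theta>_def field_simps)
    finally show ?thesis .
  qed
  have geo: "norm ((g ^^ k) w - z) \<le> \<rho> * \<theta> ^ k" if w: "w \<in> ball z \<rho>" for k w
  proof (induction k)
    case 0
    then show ?case using w by (auto simp: dist_norm norm_minus_commute)
  next
    case (Suc k)
    have "norm ((g ^^ Suc k) w - z) \<le> \<theta> * norm ((g ^^ k) w - z)" using step[OF orbit[OF w, of k]] by simp
    also have "\<dots> \<le> \<theta> * (\<rho> * \<theta> ^ k)" using Suc \<theta> by (intro mult_left_mono) auto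
    finally show ?case by (simp add: mult_ac)
  qed
  have err: "A * norm ((g ^^ k) w - z) \<le> A * \<rho> * \<theta> ^ k" if w: "w \<in> ball z \<rho>" for k w
    using mult_left_mono[OF geo[OF w, of k], of A] A by (simp add: mult_ac)
  have up: "norm ((g ^^ k) w - z) \<le> norm (w - z) * (exp (S k) * \<mu> ^ k)" if w: "w \<in> ball z \<rho>" for k w
  proof (induction k)
    case (Suc k)
    let ?x = "norm ((g ^^ k) w - z)"
    have "1 + A * ?x \<le> exp (A * \<rho> * \<theta> ^ k)"
      using err[OF w, of k] exp_ge_add_one_self[of "A * ?x"] exp_le_cancel_iff order_trans by blast
    then have "\<mu> * (1 + A * ?x) * ?x \<le> \<mu> * exp (A * \<rho> * \<theta> ^ k) * (norm (w - z) * (exp (S k) * \<mu> ^ k))"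
      using Suc \<mu> A by (intro mult_mono) auto
    then have "norm ((g ^^ Suc k) w - z) \<le> \<mu> * exp (A * \<rho> * \<theta> ^ k) * (norm (w - z) * (exp (S k) * \<mu> ^ k))"
      using le[OF orbit[OF w, of k]] by simp
    then show ?case by (simp add: S_def exp_add mult_ac)
  qed (simp add: S_def)
  \<comment> \<open>Here each step contributes 1 minus an error. As the errors are at most 1/2, an
    exponential lower bound holds at the price of a factor 2 in the exponent.\<close>
  have low: "exp (- 2 * S k) * \<mu> ^ k \<le> norm (deriv (g ^^ k) w)" if w: "w \<in> ball z \<rho>" for k w
  proof (induction k)
    case (Suc k)
    let ?x = "norm ((g ^^ k) w - z)"
    have dk: "((g ^^ k) has_field_derivative deriv (g ^^ k) w) (at w)"
      using holomorphic_derivI[OF holk open_ball w] .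
    have "(g has_field_derivative deriv g ((g ^^ k) w)) (at ((g ^^ k) w))"
      using holomorphic_derivI[OF hol T(1)] orbit[OF w] \<rho>(3) by blast
    then have "(g \<circ> (g ^^ k) has_field_derivative deriv g ((g ^^ k) w) * deriv (g ^^ k) w) (at w)"
      using DERIV_chain dk by blast
    then have d: "deriv (g ^^ Suc k) w = deriv g ((g ^^ k) w) * deriv (g ^^ k) w"
      by (simp add: DERIV_imp_deriv)
    have "A * \<rho> * \<theta> ^ k \<le> A * \<rho>" using A \<rho> \<theta> by (simp add: mult_left_le power_le_one)
    then have half: "A * \<rho> * \<theta> ^ k \<le> 1 / 2" using \<rho>(2) \<mu> by simp
    have "exp (- 2 * (A * \<rho> * \<theta> ^ k)) \<le> 1 - A * \<rho> * \<theta> ^ k"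
      using A \<rho> \<theta> half by (intro exp_neg_double_le_one_minus) auto
    also have "\<dots> \<le> 1 - A * ?x" using err[OF w, of k] by simp
    finally have "\<mu> * exp (- 2 * (A * \<rho> * \<theta> ^ k)) \<le> norm (deriv g ((g ^^ k) w))"
      using ge[OF orbit[OF w, of k]] mult_left_mono[of _ _ \<mu>] \<mu>(2) by (meson less_imp_le order_trans)
    then have "\<mu> * exp (- 2 * (A * \<rho> * \<theta> ^ k)) * (exp (- 2 * S k) * \<mu> ^ k) \<le> norm (deriv (g ^^ Suc k) w)"
      unfolding d norm_mult using Suc \<mu> by (intro mult_mono) auto
    moreover have "S (Suc k) = S k + A * \<rho> * \<theta> ^ k" by (simp add: S_def)
    then have "exp (- 2 * S (Suc k)) = exp (- 2 * (A * \<rho> * \<theta> ^ k)) * exp (- 2 * S k)"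
      by (simp add: algebra_simps flip: exp_add)
    ultimately show ?case by (simp only: power_Suc mult_ac)
  qed (simp add: S_def)
  show thesis
  proof (rule that[OF \<rho>(1) \<rho>(3) holk orbit])
    fix k w assume w: "w \<in> ball z \<rho>"
    have "norm (w - z) * (exp (S k) * \<mu> ^ k) \<le> norm (w - z) * (exp 1 * \<mu> ^ k)"
      using S \<mu> by (intro mult_left_mono mult_right_mono) auto
    also have "\<dots> < \<rho> * (exp 1 * \<mu> ^ k)"
      using w \<mu> by (intro mult_strict_right_mono) (auto simp: dist_norm norm_minus_commute)
    finally show "norm ((g ^^ k) w - z) < \<rho> * exp 1 * \<mu> ^ k"
      using up[OF w, of k] by (simp add: mult_ac)
    have "exp (- 2) * \<mu> ^ k \<le> exp (- 2 * S k) * \<mu> ^ k"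
      using S[of k] \<mu> by (intro mult_right_mono) auto
    then show "norm (deriv (g ^^ k) w) \<ge> exp (- 2) * \<mu> ^ k" using low[OF w, of k] by simp
  qed
qed

text \<open>
  If \<open>G\<close> is backward invariant under a local attracting map, one ball in the complement of \<open>G\<close>
  near the fixed point reappears at every scale.
\<close>

lemma porous_at_attracting_fixpoint:
  fixes g :: "complex \<Rightarrow> complex"
  assumes hol: "g holomorphic_on T" and T: "open T" "z \<in> T" and fp: "g z = z"
    and \<mu>: "0 < norm (deriv g z)" "norm (deriv g z) < 1"
    and inv: "\<And>w. w \<in> T \<Longrightarrow> g w \<in> G \<Longrightarrow> w \<in> G"
    and gap: "\<And>U. open U \<Longrightarrow> z \<in> U \<Longrightarrow> \<not> U \<subseteq> closure G"
  shows "porous_at (closure G) z"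
proof -
  define \<mu> where "\<mu> = norm (deriv g z)"
  have \<mu>': "0 < \<mu>" "\<mu> < 1" using \<mu> by (auto simp: \<mu>_def)
  obtain \<rho> where \<rho>: "\<rho> > 0" "ball z \<rho> \<subseteq> T"
    and holk: "\<And>k. (g ^^ k) holomorphic_on ball z \<rho>"
    and orbit: "\<And>k w. w \<in> ball z \<rho> \<Longrightarrow> (g ^^ k) w \<in> ball z \<rho>"
    and up: "\<And>k w. w \<in> ball z \<rho> \<Longrightarrow> norm ((g ^^ k) w - z) < \<rho> * exp 1 * \<mu> ^ k"
    and low: "\<And>k w. w \<in> ball z \<rho> \<Longrightarrow> norm (deriv (g ^^ k) w) \<ge> exp (- 2) * \<mu> ^ k"
    using attracting_fixpoint_bounded_distortion[OF hol T fp \<mu>_def[symmetric] \<mu>'] by blast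
  obtain p where p: "p \<in> ball z \<rho> - closure G" using gap[OF open_ball, of z \<rho>] \<rho>(1) by (metis DiffI centre_in_ball subsetI)
  have "open (ball z \<rho> - closure G)" by auto
  then obtain \<epsilon> where \<epsilon>: "\<epsilon> > 0" "ball p \<epsilon> \<subseteq> ball z \<rho> - closure G" using p openE by blast
  have invk: "w \<in> G" if "w \<in> ball z \<rho>" "(g ^^ k) w \<in> G" for w k
    using that(2)
  proof (induction k)
    case (Suc k)
    then show ?case using inv[of "(g ^^ k) w"] orbit[OF that(1), of k] \<rho>(2) by auto
  qed simp
  \<comment> \<open>\<open>C * \<mu> ^ k\<close> bounds the \<open>k\<close>-th image of the disc
    about \<open>z\<close>. Bloch's theorem, with constant 1/12, puts a ball of radius
    \<open>s * \<mu> ^ k\<close> into the \<open>k\<close>-th image of the hole about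
    \<open>p\<close>.\<close>
  define C where "C = \<rho> * exp 1"
  define s where "s = \<epsilon> * exp (- 2) / 12"
  have C: "C > 0" and s: "s > 0" using \<rho> \<epsilon> by (auto simp: C_def s_def)
  have holes: "\<exists>y. ball y (s * \<mu> ^ k) \<subseteq> ball z (C * \<mu> ^ k) - closure G" for k
  proof -
    have "(g ^^ k) holomorphic_on ball p \<epsilon>"
      using holk by (rule holomorphic_on_subset) (use \<epsilon> in auto)
    moreover have "s * \<mu> ^ k \<le> \<epsilon> * norm (deriv (g ^^ k) p) / 12"
      using low[of p k] p \<epsilon>(1) by (simp add: s_def mult.assoc)
    ultimately obtain y where y: "ball y (s * \<mu> ^ k) \<subseteq> (g ^^ k) ` ball p \<epsilon>"
      using Bloch \<epsilon>(1) by metis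
    have "(g ^^ k) ` ball p \<epsilon> \<subseteq> ball z (C * \<mu> ^ k) - G"
    proof safe
      fix w assume "w \<in> ball p \<epsilon>"
      then have w: "w \<in> ball z \<rho>" "w \<notin> G" using \<epsilon>(2) closure_subset[of G] by auto
      show "(g ^^ k) w \<in> ball z (C * \<mu> ^ k)"
        using up[OF w(1)] by (simp add: C_def dist_norm norm_minus_commute)
      show False if "(g ^^ k) w \<in> G" using invk[OF w(1) that] w(2) by blast
    qed
    with y have "ball y (s * \<mu> ^ k) \<subseteq> ball z (C * \<mu> ^ k) - G" by blast
    moreover from this have "ball y (s * \<mu> ^ k) \<inter> closure G = {}"
      using open_Int_closure_eq_empty[OF open_ball, of y "s * \<mu> ^ k" G] by blast
    ultimately show ?thesis by blast
  qed
  \<comment> \<open>A scale \<open>r\<close> lies between \<open>C * \<mu> ^ k\<close> and the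
    preceding \<open>C * \<mu> ^ (k - 1)\<close>, which costs one factor \<open>\<mu>\<close>. The
    cap 1/2 keeps \<open>c\<close> below 1.\<close>
  define c where "c = min (s * \<mu> / C) (1 / 2)"
  have c: "0 < c" "c < 1" "c \<le> s * \<mu> / C" using C s \<mu>' by (auto simp: c_def)
  have "por (closure G) z r \<ge> c" if r: "0 < r" "r < C" for r
  proof -
    obtain k0 where "\<mu> ^ k0 < r / C" using real_arch_pow_inv[of "r / C" \<mu>] r C \<mu>' by auto
    then have "C * \<mu> ^ k0 \<le> r" using C by (simp add: field_simps)
    then obtain k where k: "C * \<mu> ^ k \<le> r" "\<And>j. j < k \<Longrightarrow> \<not> C * \<mu> ^ j \<le> r"
      using exists_least_iff[of "\<lambda>k. C * \<mu> ^ k \<le> r"] by blast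
    have "k \<noteq> 0" using k(1) r by (cases k) auto
    then obtain j where j: "k = Suc j" using not0_implies_Suc by blast
    then have rj: "r < C * \<mu> ^ j" using k(2)[of j] by simp
    have "c * r \<le> (s * \<mu> / C) * (C * \<mu> ^ j)"
      using c rj r s C \<mu>' by (intro mult_mono) auto
    also have "\<dots> = s * \<mu> ^ k" using C by (simp add: j)
    finally have cr: "c * r \<le> s * \<mu> ^ k" .
    obtain y where "ball y (s * \<mu> ^ k) \<subseteq> ball z (C * \<mu> ^ k) - closure G" using holes by blast
    then have "ball y (c * r) \<subseteq> ball z r - closure G"
      using subset_ball[OF cr, of y] subset_ball[OF k(1), of z] by blast
    then show ?thesis using le_por[of r c y z] r c by simp
  qed
  then show ?thesis
    unfolding porous_at_def using c C by (intro bexI[of _ c] exI[of _ C] conjI ballI) auto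
qed

section \<open>Elliptic functions and their iterates\<close>

locale nonconst_elliptic =
  fixes f :: "complex \<Rightarrow> complex"
  assumes elliptic: "elliptic f"
    and nonconst: "\<not> sphere_map f constant_on UNIV"
begin

lemma nicely_mero: "f nicely_meromorphic_on UNIV"
  using elliptic by (simp add: elliptic_def)

lemma mero: "f meromorphic_on UNIV"
  using nicely_mero by (simp add: nicely_meromorphic_on_def)

lemma isolated: "isolated_singularity_at f z"
  by (meson UNIV_I mero meromorphic_on_isolated_singularity meromorphic_on_meromorphic_at)

lemma not_pole_iff: "\<not> is_pole f z \<longleftrightarrow> f analytic_on {z}"
  by (rule nicely_meromorphic_not_pole_iff[OF nicely_mero])

lemma pole_value: "is_pole f z \<Longrightarrow> f z = 0"
  using nicely_mero unfolding nicely_meromorphic_on_def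
  by (meson UNIV_I at_neq_bot is_pole_def not_tendsto_and_filterlim_at_infinity)

lemma periods_relatively_dense: obtains D where "D > 0" "\<And>z. \<exists>w\<in>periods f. norm (z - w) \<le> D"
proof -
  obtain w1 w2 where w: "w1 \<noteq> 0" "Im (w2 / w1) \<noteq> 0" "w1 \<in> periods f" "w2 \<in> periods f"
    using elliptic by (auto simp: elliptic_def periods_def)
  obtain D where D: "\<And>z. \<exists>m n. norm (z - (of_int m * w1 + of_int n * w2)) \<le> D"
    using lattice_relatively_dense[OF w(1,2)] by blast
  have "\<exists>w\<in>periods f. norm (z - w) \<le> max D 1" for z
  proof -
    obtain m n where "norm (z - (of_int m * w1 + of_int n * w2)) \<le> D" using D by blast
    moreover have "of_int m * w1 + of_int n * w2 \<in> periods f"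
      by (intro periods_add periods_of_int_mult w)
    ultimately show ?thesis by (intro bexI[of _ "of_int m * w1 + of_int n * w2"]) auto
  qed
  then show thesis using that[of "max D 1"] by auto
qed

lemma period_sphere_map: "w \<in> periods f \<Longrightarrow> sphere_map f (z + w) = sphere_map f z"
  by (simp add: periods_def)

lemma period_is_pole: "w \<in> periods f \<Longrightarrow> is_pole f (z + w) \<longleftrightarrow> is_pole f z"
  using period_sphere_map[of w z] by (auto simp: sphere_map_def split: if_splits)

text \<open>At a pole both sides are the dummy value 0.\<close>

lemma period_f: "w \<in> periods f \<Longrightarrow> f (z + w) = f z"
  using period_sphere_map[of w z] by (auto simp: sphere_map_def pole_value split: if_splits)

lemma period_deriv:
  assumes "w \<in> periods f"
  shows "deriv f (z + w) = deriv f z"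
proof -
  have "(\<lambda>x. f (x + w)) = f" using period_f[OF assms] by auto
  then show ?thesis
    using DERIV_shift[of f _ z w] by (simp add: deriv_def)
qed

text \<open>Translating by periods, every value is already taken on one closed disc, so
  \<open>h\<close> is bounded and Liouville's theorem applies.\<close>

lemma holomorphic_periodic_imp_const:
  assumes hol: "h holomorphic_on UNIV" and per: "\<And>z w. w \<in> periods f \<Longrightarrow> h (z + w) = h z"
  shows "h constant_on UNIV"
proof -
  obtain D where D: "D > 0" "\<And>z. \<exists>w\<in>periods f. norm (z - w) \<le> D"
    using periods_relatively_dense by blast
  have "compact (h ` cball 0 D)"
    by (meson compact_cball compact_continuous_image hol holomorphic_on_imp_continuous_on
        holomorphic_on_subset subset_UNIV)
  moreover have "range h \<subseteq> h ` cball 0 D"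
  proof
    fix v assume "v \<in> range h"
    then obtain z where "v = h z" by auto
    obtain w where w: "w \<in> periods f" "norm (z - w) \<le> D" using D by blast
    have "h (z - w) = h z" using per[OF periods_minus[OF w(1)], of z] by simp
    then show "v \<in> h ` cball 0 D" using w \<open>v = h z\<close> by (auto intro!: image_eqI[of _ _ "z - w"])
  qed
  ultimately have "bounded (range h)" using bounded_subset compact_imp_bounded by blast
  then show ?thesis using Liouville_theorem[OF hol] by (auto simp: constant_on_def)
qed

text \<open>By the identity theorem a value taken at points accumulating at \<open>z\<close> would
  be the only value of \<open>f\<close>, leaving no poles and a constant
  \<open>sphere_map f\<close>.\<close>

lemma eventually_neq: "\<forall>\<^sub>F w in at z. f w \<noteq> c"
proof (rule ccontr)
  assume "\<not> ?thesis"
  then have "\<exists>\<^sub>F w in at z. f w = c" by (simp add: frequently_def)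
  then have "f w = c" for w
    by (rule frequently_eq_meromorphic_imp_constant[OF _ nicely_mero]) auto
  then have "f = (\<lambda>_. c)" by auto
  then have "\<not> is_pole f w" for w using not_is_pole_holomorphic[of UNIV w f] by auto
  then have "sphere_map f constant_on UNIV"
    using \<open>f = (\<lambda>_. c)\<close> by (auto simp: sphere_map_def constant_on_def)
  then show False using nonconst by contradiction
qed

text \<open>If infinity were omitted, \<open>f\<close> would be entire; if a finite \<open>b\<close>
  were omitted, \<open>1 / (f - b)\<close> would be. Both are periodic, hence constant, contrary to
  the choice of \<open>f\<close>.\<close>

lemma sphere_map_surj:
  obtains z where "sphere_map f z = x"
proof -
  have False if omit: "\<And>z. sphere_map f z \<noteq> x"
  proof (cases x)
    case None
    then have "\<not> is_pole f z" for z using omit[of z] by (auto simp: sphere_map_def)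
    then have "f holomorphic_on UNIV"
      using not_pole_iff analytic_imp_holomorphic analytic_on_analytic_at by blast
    then have "f constant_on UNIV"
      by (rule holomorphic_periodic_imp_const) (simp add: period_f)
    then obtain c where "f z = c" for z by (auto simp: constant_on_def)
    then show False using eventually_neq[of c 0] by simp
  next
    case (Some b)
    \<comment> \<open>The value 0 at the poles of \<open>f\<close> is the holomorphic extension of
      the reciprocal.\<close>
    define h where "h = (\<lambda>z. if is_pole f z then 0 else inverse (f z - b))"
    have "h analytic_on {z}" for z
    proof (cases "is_pole f z")
      case False
      then have an: "f analytic_on {z}" using not_pole_iff by blast
      moreover have "f z \<noteq> b" using omit[of z] Some False by (auto simp: sphere_map_def)
      ultimately have "(\<lambda>z. inverse (f z - b)) analytic_on {z}"
        by (auto intro!: analytic_intros)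
      moreover have "\<forall>\<^sub>F w in nhds z. inverse (f w - b) = h w"
        using eventually_not_pole[OF isolated, of z] False
        by (auto simp: h_def eventually_nhds_conv_at elim: eventually_mono)
      ultimately show ?thesis using analytic_at_cong[of "\<lambda>z. inverse (f z - b)" h z z] by blast
    next
      case True
      have pole: "is_pole (\<lambda>w. f w - b) z" using True by (simp add: is_pole_minus_const_iff)
      have "\<forall>\<^sub>F w in at z. \<not> is_pole f w \<and> f w - b \<noteq> 0"
        using eventually_not_pole[OF isolated, of z] non_zero_neighbour_pole[OF pole]
        by (rule eventually_conj)
      then obtain r where r: "r > 0" "\<And>w. w \<in> ball z r - {z} \<Longrightarrow> \<not> is_pole f w \<and> f w - b \<noteq> 0"
        by (auto simp: eventually_at dist_commute)
      then have "f analytic_on ball z r - {z}"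
        using not_pole_iff analytic_on_analytic_at by blast
      then have "(\<lambda>w. f w - b) holomorphic_on ball z r - {z}"
        by (intro holomorphic_intros) (simp add: analytic_imp_holomorphic)
      then have "(\<lambda>w. if w = z then 0 else inverse (f w - b)) holomorphic_on ball z r"
        by (rule is_pole_inverse_holomorphic[OF open_ball _ pole]) (use r in auto)
      then have "h holomorphic_on ball z r"
        by (rule holomorphic_transform) (use r True in \<open>auto simp: h_def\<close>)
      then show ?thesis using r(1) analytic_at centre_in_ball open_ball by blast
    qed
    then have "h holomorphic_on UNIV"
      using analytic_imp_holomorphic analytic_on_analytic_at by blast
    then have "h constant_on UNIV"
      by (rule holomorphic_periodic_imp_const) (simp add: period_f period_is_pole h_def)
    then obtain c where c: "h z = c" for z by (auto simp: constant_on_def)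
    have "f w = b + inverse c" if "\<not> is_pole f w" for w
      using c[of w] that by (auto simp: h_def)
    then have "\<forall>\<^sub>F w in at 0. f w = b + inverse c"
      using eventually_not_pole[OF isolated, of 0] by (auto elim: eventually_mono)
    then have "\<forall>\<^sub>F w in at (0::complex). False"
      using eventually_neq[of "b + inverse c" 0] by eventually_elim auto
    then show False by simp
  qed
  then show thesis using that by blast
qed

section \<open>Iterates and prepoles\<close>

abbreviation J :: "complex set" where "J \<equiv> julia_set f"
abbreviation P :: "complex set" where "P \<equiv> prepoles f"
text \<open>Meaningful only where the iterate is finite; elsewhere it is the unspecified
  \<open>the None\<close>.\<close>

abbreviation F :: "nat \<Rightarrow> complex \<Rightarrow> complex" where "F n z \<equiv> the (iterate f n z)"

lemma iterate_add: "iterate f (m + n) z = Option.bind (iterate f m z) (iterate f n)"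
  by (induction n) (cases "iterate f m z"; simp)+

lemma iterate_None_mono: "iterate f m z = None \<Longrightarrow> m \<le> n \<Longrightarrow> iterate f n z = None"
  using iterate_add[of m "n - m" z] by simp

text \<open>The least \<open>n\<close> with value \<open>None\<close> satisfies
  \<open>iterate_defined\<close>, and it is positive because the zeroth iterate is finite.\<close>

lemma mem_prepoles_iff: "z \<in> P \<longleftrightarrow> (\<exists>n. iterate f n z = None)"
proof
  assume "\<exists>n. iterate f n z = None"
  then obtain n where n: "iterate f n z = None" "\<And>k. k < n \<Longrightarrow> iterate f k z \<noteq> None"
    using exists_least_iff[of "\<lambda>n. iterate f n z = None"] by blast
  then have "n \<ge> 1" by (cases n) auto
  then show "z \<in> P" using n by (auto simp: prepoles_def iterate_defined_def)
qed (auto simp: prepoles_def)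

text \<open>The orbit of \<open>v\<close> is a tail of the orbit of \<open>u\<close>, and
  \<open>None\<close> is absorbing. This two-way invariance carries prepoles forward and backward
  along finite iterates.\<close>

lemma iterate_mem_prepoles_iff:
  assumes "iterate f n u = Some v"
  shows "v \<in> P \<longleftrightarrow> u \<in> P"
proof -
  have *: "iterate f (n + m) u = iterate f m v" for m using assms iterate_add[of n m u] by simp
  show ?thesis
  proof
    assume "u \<in> P"
    then obtain m where "iterate f m u = None" using mem_prepoles_iff by blast
    then have "iterate f (n + m) u = None" using iterate_None_mono by simp
    then show "v \<in> P" using * mem_prepoles_iff by metis
  qed (metis * mem_prepoles_iff)
qed

lemma pole_mem_prepoles: "is_pole f z \<Longrightarrow> z \<in> P"
  unfolding mem_prepoles_iff by (intro exI[of _ 1]) (simp add: sphere_map_def)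

lemma period_prepoles:
  assumes "w \<in> periods f"
  shows "z + w \<in> P \<longleftrightarrow> z \<in> P"
proof -
  \<comment> \<open>The two orbits agree from index 1 on; the zeroth iterates differ unless
    \<open>w = 0\<close>.\<close>
  have *: "iterate f (1 + n) (z + w) = iterate f (1 + n) z" for n
    unfolding iterate_add using period_sphere_map[OF assms] by simp
  have "(\<exists>n. iterate f n x = None) \<longleftrightarrow> (\<exists>n. iterate f (1 + n) x = None)" for x
    by (metis iterate_None_mono le_add2)
  then show ?thesis unfolding mem_prepoles_iff * by (simp only: *)
qed

lemma pole_in_ball: obtains D where "D > 0" "\<And>z r. r > D \<Longrightarrow> \<exists>p\<in>ball z r. is_pole f p"
proof -
  obtain p where p: "is_pole f p"
    using sphere_map_surj[of None] by (metis option.distinct(1) sphere_map_def)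
  obtain D where D: "D > 0" "\<And>z. \<exists>w\<in>periods f. norm (z - w) \<le> D"
    using periods_relatively_dense by blast
  have "\<exists>p\<in>ball z r. is_pole f p" if "r > D" for z r
  proof -
    obtain w where w: "w \<in> periods f" "norm (z - p - w) \<le> D" using D by blast
    then show ?thesis using p period_is_pole[OF w(1), of p] that
      by (intro bexI[of _ "p + w"]) (auto simp: dist_norm algebra_simps)
  qed
  then show thesis using that D(1) by blast
qed

text \<open>The punctured filter \<open>at (f z)\<close> records that nearby values differ from
  \<open>f z\<close>, so the limit can be composed with a map having a pole at
  \<open>f z\<close>.\<close>

lemma filterlim_at_not_pole:
  assumes "\<not> is_pole f z"
  shows "filterlim f (at (f z)) (at z)"
  using assms not_pole_iff analytic_at_imp_isCont eventually_neq
  by (auto simp: filterlim_at isCont_def)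

lemma iterate_finite:
  assumes "iterate f n z = Some v"
  shows "F n analytic_on {z}" "filterlim (F n) (at v) (at z)"
    "\<forall>\<^sub>F w in nhds z. iterate f n w = Some (F n w)"
proof -
  have "F n analytic_on {z} \<and> filterlim (F n) (at v) (at z) \<and>
    (\<forall>\<^sub>F w in nhds z. iterate f n w = Some (F n w))"
    using assms
  proof (induction n arbitrary: v)
    case 0
    then show ?case by (auto intro: filterlim_ident analytic_on_ident)
  next
    case (Suc n)
    then obtain u where u: "iterate f n z = Some u" "sphere_map f u = Some v"
      by (auto simp: bind_eq_Some_conv)
    then have np: "\<not> is_pole f u" and v: "v = f u" by (auto simp: sphere_map_def split: if_splits)
    note IH = Suc.IH[OF u(1)]
    have Fz: "F n z = u" using u by simp
    have "isCont (F n) z" using IH analytic_at_imp_isCont by blast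
    then have lim: "filterlim (F n) (nhds u) (nhds z)"
      using Fz tendsto_at_iff_tendsto_nhds[of "F n" z] by (simp add: isCont_def)
    have "\<forall>\<^sub>F w in nhds u. \<not> is_pole f w"
      using eventually_not_pole[OF isolated, of u] np by (auto simp: eventually_nhds_conv_at)
    then have "\<forall>\<^sub>F w in nhds z. \<not> is_pole f (F n w)"
      using lim by (auto simp: filterlim_iff)
    moreover have "\<forall>\<^sub>F w in nhds z. iterate f n w = Some (F n w)" using IH by blast
    ultimately have ev: "\<forall>\<^sub>F w in nhds z. iterate f (Suc n) w = Some (f (F n w))"
      by eventually_elim (auto simp: sphere_map_def bind_eq_Some_conv)
    have "f analytic_on (F n) ` {z}" using np not_pole_iff Fz by simp
    then have "f \<circ> F n analytic_on {z}" using IH analytic_on_compose by blast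
    then have an: "(\<lambda>w. f (F n w)) analytic_on {z}" by (simp add: o_def)
    have ev': "\<forall>\<^sub>F w in nhds z. f (F n w) = F (Suc n) w"
      using ev by eventually_elim simp
    have "F (Suc n) analytic_on {z}" using an analytic_at_cong[OF ev' refl] by blast
    moreover have "filterlim (\<lambda>w. f (F n w)) (at v) (at z)"
      using filterlim_compose[OF filterlim_at_not_pole[OF np]] IH v by blast
    then have "filterlim (F (Suc n)) (at v) (at z)"
      using filterlim_cong[OF refl refl, of "\<lambda>w. f (F n w)" "F (Suc n)" "at z" "at v"] ev'
      by (simp add: eventually_nhds_conv_at)
    moreover have "\<forall>\<^sub>F w in nhds z. iterate f (Suc n) w = Some (F (Suc n) w)"
      using ev by eventually_elim simp
    ultimately show ?case by blast
  qed
  then show "F n analytic_on {z}" "filterlim (F n) (at v) (at z)"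
    "\<forall>\<^sub>F w in nhds z. iterate f n w = Some (F n w)" by auto
qed

text \<open>The last finite iterate of \<open>b\<close> is a pole \<open>u\<close> of
  \<open>f\<close>. Near \<open>b\<close> that iterate tends to \<open>u\<close> without taking the
  value \<open>u\<close>, so one more application of \<open>f\<close> is finite and tends to
  infinity.\<close>

lemma prepole_pole:
  assumes "b \<in> P"
  obtains n where "is_pole (F n) b" "isolated_singularity_at (F n) b"
    "\<forall>\<^sub>F w in at b. iterate f n w = Some (F n w)"
proof -
  obtain n where n: "iterate_defined f n b" "iterate f n b = None" "n \<ge> 1"
    using assms by (auto simp: prepoles_def)
  then obtain m where m: "n = Suc m" by (cases n) auto
  then obtain u where u: "iterate f m b = Some u" using n by (auto simp: iterate_defined_def)
  then have pole: "is_pole f u" using n m by (auto simp: sphere_map_def split: if_splits)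
  note it = iterate_finite[OF u]
  have "\<forall>\<^sub>F w in at b. \<not> is_pole f (F m w)"
    using eventually_not_pole[OF isolated, of u] it(2) by (auto simp: filterlim_iff)
  moreover have "\<forall>\<^sub>F w in at b. iterate f m w = Some (F m w)"
    using it(3) by (simp add: eventually_nhds_conv_at)
  ultimately have ev: "\<forall>\<^sub>F w in at b. iterate f n w = Some (f (F m w))"
    by eventually_elim (auto simp: m sphere_map_def bind_eq_Some_conv)
  have "filterlim (\<lambda>w. f (F m w)) at_infinity (at b)"
    using filterlim_compose[OF _ it(2)] pole by (auto simp: is_pole_def)
  moreover have "\<forall>\<^sub>F w in at b. f (F m w) = F n w"
    using ev by eventually_elim simp
  ultimately have 1: "is_pole (F n) b"
    unfolding is_pole_def using filterlim_cong[OF refl refl] by fast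
  have 2: "\<forall>\<^sub>F w in at b. iterate f n w = Some (F n w)"
    using ev by eventually_elim simp
  then obtain r where r: "r > 0" "\<And>w. w \<in> ball b r - {b} \<Longrightarrow> iterate f n w = Some (F n w)"
    by (auto simp: eventually_at dist_commute)
  have "F n analytic_on ball b r - {b}"
    using iterate_finite(1)[OF r(2)] analytic_on_analytic_at by blast
  then have "isolated_singularity_at (F n) b" using r(1) by (auto simp: isolated_singularity_at_def)
  with 1 2 that show thesis by blast
qed

lemma iterate_off_prepoles: "z \<notin> P \<Longrightarrow> iterate f n z = Some (F n z)"
  using mem_prepoles_iff by auto

lemma iterate_holomorphic_on:
  assumes "U \<inter> P = {}"
  shows "F n holomorphic_on U"
proof -
  have "F n analytic_on {z}" if "z \<in> U" for z
    using assms that iterate_finite(1)[OF iterate_off_prepoles] by blast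
  then show ?thesis using analytic_imp_holomorphic analytic_on_analytic_at by blast
qed

text \<open>
  By Bloch's theorem a large derivative would produce a disc in the image that is big enough
  to contain a pole. This replaces Montel's theorem throughout.
\<close>

lemma deriv_bound_off_prepoles:
  obtains M where "M > 0"
    "\<And>y s n. s > 0 \<Longrightarrow> ball y s \<inter> P = {} \<Longrightarrow> norm (deriv (F n) y) \<le> M / s"
proof -
  obtain D where D: "D > 0" "\<And>z r. r > D \<Longrightarrow> \<exists>p\<in>ball z r. is_pole f p"
    using pole_in_ball by blast
  have "norm (deriv (F n) y) \<le> 12 * D / s" if s: "s > 0" "ball y s \<inter> P = {}" for y s n
  proof (rule ccontr)
    assume "\<not> ?thesis"
    then have gt: "s * norm (deriv (F n) y) / 12 > D" using s(1) by (simp add: field_simps)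
    have "F n holomorphic_on ball y s" by (rule iterate_holomorphic_on[OF s(2)])
    then obtain c where c: "ball c (s * norm (deriv (F n) y) / 12) \<subseteq> F n ` ball y s"
      using Bloch[OF _ s(1) order_refl] by blast
    obtain p where "p \<in> ball c (s * norm (deriv (F n) y) / 12)" "is_pole f p"
      using D(2)[OF gt] by blast
    then obtain u where u: "u \<in> ball y s" "p = F n u" using c by auto
    then have "u \<notin> P" using s(2) by auto
    then have "p \<notin> P" using iterate_mem_prepoles_iff[OF iterate_off_prepoles, of u n] u by simp
    then show False using pole_mem_prepoles \<open>is_pole f p\<close> by blast
  qed
  then show thesis using that[of "12 * D"] D(1) by simp
qed

section \<open>The Julia set\<close>

text \<open>The derivative bound gives all iterates one Lipschitz constant on a small disc. They are
  therefore equicontinuous in the chordal metric, and the Arzela-Ascoli theorem yields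
  normality.\<close>

lemma off_prepoles_subset_fatou:
  assumes U: "open U" "U \<inter> P = {}"
  shows "U \<subseteq> fatou_set f"
proof
  fix z assume "z \<in> U"
  obtain M where M: "M > 0"
    "\<And>y s n. s > 0 \<Longrightarrow> ball y s \<inter> P = {} \<Longrightarrow> norm (deriv (F n) y) \<le> M / s"
    using deriv_bound_off_prepoles by blast
  obtain e where e: "e > 0" "ball z e \<subseteq> U" using U(1) \<open>z \<in> U\<close> openE by blast
  \<comment> \<open>Half the radius, so that a ball of radius \<open>r\<close> about any point of
    \<open>cball z r\<close> still avoids the prepoles.\<close>
  define r where "r = e / 2"
  have r: "r > 0" "e = 2 * r" using e(1) by (auto simp: r_def)
  let ?S = "cball z r"
  have subP: "ball x r \<inter> P = {}" if "x \<in> ?S" for x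
  proof -
    have "ball x r \<subseteq> ball z e"
    proof
      fix y assume "y \<in> ball x r"
      then show "y \<in> ball z e" using that r dist_triangle[of z y x] by auto
    qed
    then show ?thesis using e(2) U(2) by blast
  qed
  have nP: "x \<notin> P" if "x \<in> ?S" for x
    using subP[OF that] r(1) by (metis IntI centre_in_ball empty_iff)
  have lip: "norm (F n x - F n y) \<le> M / r * norm (x - y)" if "x \<in> ?S" "y \<in> ?S" for n x y
  proof (rule field_differentiable_bound[OF convex_cball])
    fix u assume "u \<in> ?S"
    then have "F n analytic_on {u}" using iterate_finite(1)[OF iterate_off_prepoles] nP by blast
    then show "(F n has_field_derivative deriv (F n) u) (at u within ?S)"
      using analytic_derivI by blast
    show "norm (deriv (F n) u) \<le> M / r" by (rule M(2)[OF r(1) subP[OF \<open>u \<in> ?S\<close>]])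
  qed (use that in auto)
  have "normal_family_on {iterate f n |n. n \<ge> 1} (ball z r)"
    unfolding normal_family_on_def
  proof (intro allI impI)
    fix s :: "nat \<Rightarrow> complex \<Rightarrow> sphere" assume "range s \<subseteq> {iterate f n |n. n \<ge> 1}"
    then have "\<exists>n. s k = iterate f n" for k by (auto simp: image_subset_iff)
    then obtain m where m: "\<And>k. s k = iterate f (m k)" by metis
    let ?A = "\<lambda>k x. stereographic (s k x)"
    have lipA: "norm (?A k x - ?A k y) \<le> 2 * (M / r * norm (x - y))" if "x \<in> ?S" "y \<in> ?S" for k x y
    proof -
      have *: "s k x = Some (F (m k) x)" "s k y = Some (F (m k) y)"
        using iterate_off_prepoles nP that m by metis+
      have "norm (?A k x - ?A k y) \<le> 2 * norm (F (m k) x - F (m k) y)"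
        unfolding * by (rule stereographic_lipschitz)
      also have "\<dots> \<le> 2 * (M / r * norm (x - y))" by (intro mult_left_mono lip that) simp
      finally show ?thesis .
    qed
    obtain g0 k where k: "strict_mono (k :: nat \<Rightarrow> nat)"
      and g0: "\<And>\<epsilon>. 0 < \<epsilon> \<Longrightarrow> \<exists>N. \<forall>n x. n \<ge> N \<and> x \<in> ?S \<longrightarrow> norm (?A (k n) x - g0 x) < \<epsilon>"
    proof (rule Arzela_Ascoli[of ?S ?A 1])
      show "\<exists>d>0. \<forall>n y. y \<in> ?S \<and> norm (x - y) < d \<longrightarrow> norm (?A n x - ?A n y) < \<epsilon>"
        if "x \<in> ?S" "0 < \<epsilon>" for x \<epsilon>
      proof (intro exI[of _ "\<epsilon> * r / (2 * M)"] conjI allI impI)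
        fix n y assume y: "y \<in> ?S \<and> norm (x - y) < \<epsilon> * r / (2 * M)"
        have "norm (?A n x - ?A n y) \<le> 2 * (M / r * norm (x - y))" using lipA that y by blast
        also have "\<dots> < \<epsilon>" using y M(1) r(1) by (simp add: field_simps)
        finally show "norm (?A n x - ?A n y) < \<epsilon>" .
      qed (use that M r in auto)
    qed (auto simp: norm_stereographic)
    \<comment> \<open>The limit lies a priori in the ambient space; as a limit of unit vectors it is
      the image of a point of the sphere.\<close>
    have norm_g0: "g0 x \<in> range stereographic" if "x \<in> ?S" for x
    proof (rule unit_sphere_eq_range_stereographic)
      have "(\<lambda>n. ?A (k n) x) \<longlonglongrightarrow> g0 x"
        unfolding LIMSEQ_iff using g0 that by blast
      then have "(\<lambda>n. norm (?A (k n) x)) \<longlonglongrightarrow> norm (g0 x)" by (rule tendsto_norm)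
      then show "norm (g0 x) = 1" by (simp add: norm_stereographic LIMSEQ_const_iff)
    qed
    define g where "g x = (SOME y. stereographic y = g0 x)" for x
    have g: "stereographic (g x) = g0 x" if "x \<in> ?S" for x
      unfolding g_def by (rule someI_ex) (use norm_g0[OF that] in auto)
    have "uniform_limit K (\<lambda>n x. ?A (k n) x) (\<lambda>x. stereographic (g x)) sequentially"
      if "K \<subseteq> ball z r" for K
      unfolding uniform_limit_sequentially_iff
    proof (intro allI impI)
      fix \<epsilon> :: real assume "\<epsilon> > 0"
      then obtain N where "\<forall>n x. n \<ge> N \<and> x \<in> ?S \<longrightarrow> norm (?A (k n) x - g0 x) < \<epsilon>" using g0 by blast
      then show "\<exists>N. \<forall>n\<ge>N. \<forall>x\<in>K. dist (?A (k n) x) (stereographic (g x)) < \<epsilon>"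
        using that g by (metis ball_subset_cball dist_norm subsetD)
    qed
    then show "\<exists>r' g. strict_mono r' \<and> (\<forall>K. compact K \<and> K \<subseteq> ball z r \<longrightarrow>
        uniform_limit K (\<lambda>n z. stereographic (s (r' n) z)) (\<lambda>z. stereographic (g z)) sequentially)"
      using k by blast
  qed
  moreover have "iterate_defined f n w" if "w \<in> ball z r" for n w
    unfolding iterate_defined_def using nP[of w] that mem_prepoles_iff[of w] by simp
  ultimately show "z \<in> fatou_set f"
    using r(1) unfolding fatou_set_def by (auto intro!: exI[of _ "ball z r"])
qed

text \<open>The Fatou set is open and contains no prepole; conversely the complement of
  \<open>closure P\<close> is an open set without prepoles.\<close>

lemma julia_set_eq: "J = closure P"
proof (intro equalityI)
  have "fatou_set f \<inter> P = {}"
  proof -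
    have "z \<notin> P" if "z \<in> fatou_set f" for z
    proof
      assume "z \<in> P"
      then obtain n where n: "iterate f n z = None" using mem_prepoles_iff by blast
      \<comment> \<open>The index is \<open>Suc n\<close> because definedness of an iterate
        constrains only the strictly earlier ones.\<close>
      have "iterate_defined f (Suc n) z" using that by (auto simp: fatou_set_def)
      then show False using n by (auto simp: iterate_defined_def)
    qed
    then show ?thesis by blast
  qed
  moreover have "open (fatou_set f)"
    unfolding open_subopen[of "fatou_set f"] by (auto simp: fatou_set_def)
  ultimately show "closure P \<subseteq> J"
    unfolding julia_set_def by (intro closure_minimal) auto
  have "- closure P \<subseteq> fatou_set f"
    using closure_subset by (intro off_prepoles_subset_fatou) auto
  then show "J \<subseteq> closure P" by (auto simp: julia_set_def)
qed

text \<open>A hole of radius \<open>\<kappa> * r\<close> about \<open>y\<close> bounds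
  \<open>deriv (F n) y\<close> by \<open>M / (\<kappa> * r)\<close>. Since
  \<open>norm (y - b) < r\<close>, the product with \<open>y - b\<close> is then at most
  \<open>M / \<kappa>\<close>, independently of \<open>r\<close>, although it tends to infinity at
  \<open>b\<close>.\<close>

lemma por_julia_prepole_le:
  assumes "b \<in> P" "\<kappa> > 0"
  obtains R where "R > 0" "\<And>r. 0 < r \<Longrightarrow> r < R \<Longrightarrow> por J b r \<le> \<kappa>"
proof -
  obtain M where M: "M > 0"
    "\<And>y s n. s > 0 \<Longrightarrow> ball y s \<inter> P = {} \<Longrightarrow> norm (deriv (F n) y) \<le> M / s"
    using deriv_bound_off_prepoles by blast
  obtain n where n: "is_pole (F n) b" "isolated_singularity_at (F n) b"
    using prepole_pole[OF assms(1)] by blast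
  have "filterlim (\<lambda>z. norm ((z - b) * deriv (F n) z)) at_top (at b)"
    using is_pole_linear_times_deriv[OF n] unfolding is_pole_def
    by (rule filterlim_at_infinity_imp_norm_at_top)
  then have "\<forall>\<^sub>F z in at b. M / \<kappa> < norm ((z - b) * deriv (F n) z)"
    unfolding filterlim_at_top_dense by blast
  then obtain R where R: "R > 0"
    "\<And>z. z \<noteq> b \<Longrightarrow> dist z b < R \<Longrightarrow> M / \<kappa> < norm ((z - b) * deriv (F n) z)"
    by (auto simp: eventually_at)
  have "por J b r \<le> \<kappa>" if r: "0 < r" "r < R" for r
  proof (rule por_le)
    fix y
    have pos: "\<kappa> * r > 0" using assms r by simp
    show "\<not> ball y (\<kappa> * r) \<subseteq> ball b r - J"
    proof
      assume sub: "ball y (\<kappa> * r) \<subseteq> ball b r - J"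
      then have y: "dist y b < r" "y \<notin> J"
        using pos subsetD[OF sub, of y] by (auto simp: dist_commute[of b])
      have "b \<in> J" using assms(1) closure_subset by (auto simp: julia_set_eq)
      then have "y \<noteq> b" using y by auto
      have "ball y (\<kappa> * r) \<inter> P = {}" using sub closure_subset[of P] by (auto simp: julia_set_eq)
      then have le: "norm (deriv (F n) y) \<le> M / (\<kappa> * r)" using M(2) pos by blast
      have "norm ((y - b) * deriv (F n) y) \<le> r * (M / (\<kappa> * r))"
        unfolding norm_mult using y(1) le r by (intro mult_mono) (auto simp: dist_norm)
      also have "\<dots> = M / \<kappa>" using r by simp
      finally show False using R(2)[of y] \<open>y \<noteq> b\<close> y r by simp
    qed
  qed (use r assms in auto)
  then show thesis using that R(1) by blast
qed

lemma prepole_not_porous: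
  assumes "b \<in> P"
  shows "\<not> porous_at J b"
proof
  assume "porous_at J b"
  then obtain c r0 where c: "c > 0" "r0 > 0" "\<And>r. 0 < r \<Longrightarrow> r < r0 \<Longrightarrow> por J b r \<ge> c"
    by (auto simp: porous_at_def)
  obtain R where R: "R > 0" "\<And>r. 0 < r \<Longrightarrow> r < R \<Longrightarrow> por J b r \<le> c / 2"
    using por_julia_prepole_le[OF assms, of "c / 2"] c(1) by auto
  obtain r where "0 < r" "r < r0" "r < R" using c(2) R(1) field_lbound_gt_zero by blast
  then have "c \<le> c / 2" using c(3) R(2) by force
  then show False using c(1) by simp
qed

section \<open>Accumulation of prepoles and the interior of the Julia set\<close>

lemma large_period: obtains w where "w \<in> periods f" "norm (v + w) > R"
proof -
  obtain D where D: "D > 0" "\<And>z. \<exists>w\<in>periods f. norm (z - w) \<le> D"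
    using periods_relatively_dense by blast
  \<comment> \<open>A period within \<open>D\<close> of \<open>x - v\<close> brings
    \<open>v + w\<close> within \<open>D\<close> of \<open>x\<close>, hence to norm at least
    \<open>\<bar>R\<bar> + 1\<close>.\<close>
  define x :: complex where "x = of_real (\<bar>R\<bar> + D + 1)"
  obtain w where w: "w \<in> periods f" "norm (x - v - w) \<le> D" using D by blast
  have "norm x = \<bar>R\<bar> + D + 1" unfolding x_def norm_of_real using D by simp
  then have "norm (v + w) > R"
    using w(2) norm_triangle_ineq2[of x "v + w"] norm_minus_commute[of x "v+w"]
    by (simp add: diff_diff_eq)
  then show thesis using that w(1) by blast
qed

lemma prepole_punctured_nbhd:
  assumes b: "b \<in> P" and U: "open U" "b \<in> U"
  obtains n N R where "open N" "b \<in> N" "N \<subseteq> U"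
    "\<forall>w\<in>N - {b}. iterate f n w = Some (F n w)"
    "\<forall>v. norm v > R \<longrightarrow> (\<exists>z\<in>N - {b}. F n z = v)"
proof -
  obtain n where n: "is_pole (F n) b" "isolated_singularity_at (F n) b"
    "\<forall>\<^sub>F w in at b. iterate f n w = Some (F n w)"
    using prepole_pole[OF b] by blast
  then obtain N0 where N0: "open N0" "b \<in> N0" "\<And>w. w \<in> N0 - {b} \<Longrightarrow> iterate f n w = Some (F n w)"
    unfolding eventually_at_topological by blast
  have N: "open (N0 \<inter> U)" "b \<in> N0 \<inter> U" using N0 U by auto
  obtain R where R: "\<And>v. norm v > R \<Longrightarrow> \<exists>z\<in>N0 \<inter> U - {b}. F n z = v"
    using pole_covers_near_infinity[OF n(1,2) N] by blast
  show thesis by (rule that[OF N]) (use N0(3) R in auto)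
qed

text \<open>A pole translated far out by a period is a value of \<open>F n\<close> near
  \<open>b\<close>, and the point mapped to it is again a prepole. This allows a prepole to be moved
  slightly when its preimage is critical.\<close>

lemma prepoles_accumulate:
  assumes "b \<in> P" "open U" "b \<in> U"
  obtains z where "z \<in> P" "z \<in> U" "z \<noteq> b"
proof -
  obtain n N R where N: "open N" "b \<in> N" "N \<subseteq> U"
    "\<forall>w\<in>N - {b}. iterate f n w = Some (F n w)"
    and R: "\<forall>v. norm v > R \<longrightarrow> (\<exists>z\<in>N - {b}. F n z = v)"
    by (rule prepole_punctured_nbhd[OF assms], rule that)
  obtain p where p: "is_pole f p"
    using sphere_map_surj[of None] by (metis option.distinct(1) sphere_map_def)
  obtain w where w: "w \<in> periods f" "norm (p + w) > R" using large_period by blast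
  then obtain z where z: "z \<in> N - {b}" "F n z = p + w" using R by blast
  have "p + w \<in> P" using p period_is_pole[OF w(1)] pole_mem_prepoles by blast
  then have "z \<in> P" using iterate_mem_prepoles_iff[OF N(4)[rule_format, OF z(1)]] z(2) by simp
  then show thesis using that z N(3) by blast
qed

text \<open>Near a prepole in \<open>U\<close> the iterate \<open>F n\<close> covers a neighbourhood
  of infinity, which contains a translate of every point by a period. Density of prepoles in
  \<open>U\<close> is thus pushed forward to the whole plane.\<close>

lemma closure_prepoles_interior:
  assumes "closure P \<noteq> UNIV" "open U" "U \<noteq> {}"
  shows "\<not> U \<subseteq> closure P"
proof
  assume sub: "U \<subseteq> closure P"
  then obtain b where b: "b \<in> P" "b \<in> U"
    using assms open_Int_closure_eq_empty[OF assms(2), of P] by blast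
  obtain n N R where N: "open N" "b \<in> N" "N \<subseteq> U"
    "\<forall>w\<in>N - {b}. iterate f n w = Some (F n w)"
    and R: "\<forall>v. norm v > R \<longrightarrow> (\<exists>z\<in>N - {b}. F n z = v)"
    by (rule prepole_punctured_nbhd[OF b(1) assms(2) b(2)], rule that)
  have "v \<in> closure P" for v
  proof -
    obtain w where w: "w \<in> periods f" "norm (v + w) > R" using large_period by blast
    then obtain u where u: "u \<in> N - {b}" "F n u = v + w" using R by blast
    have opn: "open (N - {b})" using N(1) by auto
    \<comment> \<open>The approximating prepoles are taken in \<open>N - {b}\<close>, where
      \<open>F n\<close> is finite and therefore maps prepoles to prepoles.\<close>
    have "u \<in> closure ((N - {b}) \<inter> P)"
      using u(1) N(3) sub open_Int_closure_subset[OF opn, of P] by blast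
    then obtain x where x: "\<And>k. x k \<in> (N - {b}) \<inter> P" "x \<longlonglongrightarrow> u"
      unfolding closure_sequential by blast
    have "isCont (F n) u"
      using iterate_finite(1)[OF N(4)[rule_format, OF u(1)]] analytic_at_imp_isCont by blast
    then have "(\<lambda>k. F n (x k)) \<longlonglongrightarrow> v + w"
      using isCont_tendsto_compose[OF _ x(2)] u(2) by fastforce
    then have "(\<lambda>k. F n (x k) + - w) \<longlonglongrightarrow> v + w + - w" by (intro tendsto_intros)
    moreover have "F n (x k) + - w \<in> P" for k
      using iterate_mem_prepoles_iff[OF N(4)[rule_format], of "x k"] x(1)[of k]
        period_prepoles[OF periods_minus[OF w(1)]] by blast
    ultimately show ?thesis
      unfolding closure_sequential by (intro exI[of _ "\<lambda>k. F n (x k) - w"]) auto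
  qed
  then show False using assms(1) by blast
qed

section \<open>Repelling periodic points\<close>

lemma deriv_iterate_add:
  assumes "iterate f m z = Some u" "iterate f k u = Some v"
  shows "deriv (F (m + k)) z = deriv (F k) u * deriv (F m) z"
proof -
  have Fz: "F m z = u" using assms by simp
  have "(F m has_field_derivative deriv (F m) z) (at z)"
    "(F k has_field_derivative deriv (F k) u) (at u)"
    using iterate_finite(1)[OF assms(1)] iterate_finite(1)[OF assms(2)] analytic_derivI by blast+
  then have "((F k \<circ> F m) has_field_derivative deriv (F k) u * deriv (F m) z) (at z)"
    using DERIV_chain[of "F k" _ "F m" z] Fz by simp
  then have "deriv (F k \<circ> F m) z = deriv (F k) u * deriv (F m) z" by (rule DERIV_imp_deriv)
  moreover have "\<forall>\<^sub>F w in nhds z. (F k \<circ> F m) w = F (m + k) w"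
    using iterate_finite(3)[OF assms(1)]
  proof eventually_elim
    case (elim w)
    then obtain x where "iterate f m w = Some x" by simp
    then show ?case by (simp add: iterate_add)
  qed
  then have "deriv (F k \<circ> F m) z = deriv (F (m + k)) z" by (rule deriv_cong_ev) simp
  ultimately show ?thesis by simp
qed

text \<open>Along multiples of the period the derivative at \<open>z\<close> is a power of the
  multiplier, which is unbounded, whereas off \<open>closure P\<close> the derivatives of all
  iterates are bounded at each point.\<close>

lemma repelling_in_closure_prepoles:
  assumes "z \<in> repelling_periodic_points f"
  shows "z \<in> closure P"
proof (rule ccontr)
  assume "z \<notin> closure P"
  then have "z \<in> - closure P" by blast
  then obtain s where "s > 0" "ball z s \<subseteq> - closure P"
    using openE[OF open_Compl[OF closed_closure]] by blast
  then have s: "s > 0" "ball z s \<inter> P = {}" using closure_subset[of P] by auto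
  obtain M where M: "\<And>n. norm (deriv (F n) z) \<le> M / s"
    using deriv_bound_off_prepoles s by metis
  obtain n where n: "iterate f n z = Some z" "norm (deriv (F n) z) > 1"
    using assms by (auto simp: repelling_periodic_points_def)
  have "iterate f (k * n) z = Some z \<and> deriv (F (k * n)) z = deriv (F n) z ^ k" for k
  proof (induction k)
    case (Suc k)
    then show ?case using deriv_iterate_add[OF n(1), of "k * n"] iterate_add[of n "k * n" z] n(1)
      by simp
  qed simp
  then have "norm (deriv (F n) z) ^ k \<le> M / s" for k using M[of "k * n"] by (simp add: norm_power)
  then show False using real_arch_pow[OF n(2), of "M / s"] by (meson not_less)
qed

text \<open>The preimage \<open>a0\<close> of \<open>b\<close> may be a critical point of
  \<open>f\<close>. Critical points are isolated, so a nearby prepole \<open>b'\<close> with a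
  noncritical preimage \<open>a\<close> takes the place of \<open>b\<close>.\<close>

lemma prepoles_subset_closure_repelling: "P \<subseteq> closure (repelling_periodic_points f)"
proof
  fix b assume b: "b \<in> P"
  have "repelling_periodic_points f \<inter> U \<noteq> {}" if U: "open U" "b \<in> U" for U
  proof -
    obtain a0 where "sphere_map f a0 = Some b" using sphere_map_surj by blast
    then have a0: "\<not> is_pole f a0" "f a0 = b" by (auto simp: sphere_map_def split: if_splits)
    then obtain \<delta> where \<delta>: "\<delta> > 0" "f holomorphic_on ball a0 \<delta>"
      using not_pole_iff[of a0] by (auto simp: analytic_on_def)
    let ?B = "ball a0 \<delta>"
    have nconst: "\<not> f constant_on ?B"
    proof
      assume "f constant_on ?B"
      then obtain c where "\<And>w. w \<in> ?B \<Longrightarrow> f w = c" by (auto simp: constant_on_def)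
      then have "\<forall>\<^sub>F w in at a0. f w = c"
        using eventually_at_in_open'[of ?B a0] \<delta>(1) by (auto elim: eventually_mono)
      then have "\<forall>\<^sub>F w in at a0. False" using eventually_neq[of c a0] by eventually_elim simp
      then show False by simp
    qed
    then obtain \<beta> where \<beta>: "\<beta> \<in> ?B" "deriv f \<beta> \<noteq> 0"
    proof -
      have "\<exists>\<beta>\<in>?B. deriv f \<beta> \<noteq> 0"
      proof (rule ccontr)
        assume zero: "\<not> ?thesis"
        have "(f has_field_derivative 0) (at x within ?B)" if "x \<in> ?B" for x
        proof -
          have "(f has_field_derivative deriv f x) (at x within ?B)"
            using holomorphic_derivI[OF \<delta>(2) open_ball that] by (rule has_field_derivative_at_within)
          then show ?thesis using zero that by simp
        qed
        then have "\<exists>c. \<forall>x\<in>?B. f x = c" by (intro has_field_derivative_zero_constant) auto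
        then show False using nconst by (simp add: constant_on_def)
      qed
      then show ?thesis using that by blast
    qed
    have "deriv f holomorphic_on ?B" using \<delta>(2) by (auto intro: holomorphic_deriv)
    then have "\<forall>\<^sub>F w in at a0. deriv f w \<noteq> 0 \<and> w \<in> ?B"
      using non_zero_neighbour_alt[of "deriv f" ?B a0 \<beta>] \<delta>(1) \<beta> by simp
    then obtain d where d: "d > 0" "\<And>w. w \<in> ball a0 d - {a0} \<Longrightarrow> deriv f w \<noteq> 0 \<and> w \<in> ?B"
      by (auto simp: eventually_at dist_commute)
    have dsub: "ball a0 d \<subseteq> ?B" using d \<delta>(1) by force
    have "open (f ` ball a0 d)"
      using open_mapping_thm[OF \<delta>(2) open_ball connected_ball open_ball dsub nconst] .
    moreover have "b \<in> f ` ball a0 d" using a0 d(1) by force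
    ultimately have "open (f ` ball a0 d \<inter> U)" "b \<in> f ` ball a0 d \<inter> U" using U by auto
    \<comment> \<open>Being different from \<open>b\<close>, the point \<open>b'\<close> has its
      preimage off \<open>a0\<close>, where the derivative of \<open>f\<close> does not
      vanish.\<close>
    then obtain b' where b': "b' \<in> P" "b' \<in> f ` ball a0 d \<inter> U" "b' \<noteq> b"
      using prepoles_accumulate[OF b] by blast
    then obtain a where a: "a \<in> ball a0 d" "f a = b'" by blast
    then have "a \<noteq> a0" using b'(3) a0 by auto
    then have da: "deriv f a \<noteq> 0" using d(2) a by blast
    have "f holomorphic_on ball a0 d" using \<delta>(2) dsub holomorphic_on_subset by blast
    then obtain r where r: "r > 0" "ball a r \<subseteq> ball a0 d" "open (f ` ball a r)" "inj_on f (ball a r)"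
      using has_complex_derivative_locally_invertible[OF _ a(1) open_ball da] by blast
    have holr: "f holomorphic_on ball a r" using \<delta>(2) dsub r(2) holomorphic_on_subset by blast
    obtain g where g: "g holomorphic_on f ` ball a r"
        "\<And>x. x \<in> ball a r \<Longrightarrow> deriv f x * deriv g (f x) = 1" "\<And>x. x \<in> ball a r \<Longrightarrow> g (f x) = x"
      using holomorphic_has_inverse[OF holr open_ball r(4)] by blast
    let ?V = "f ` ball a r"
    have b'V: "b' \<in> ?V" using a(2) r(1) by force
    obtain n where n: "is_pole (F n) b'" "isolated_singularity_at (F n) b'"
        "\<forall>\<^sub>F w in at b'. iterate f n w = Some (F n w)"
      using prepole_pole[OF b'(1)] by blast
    \<comment> \<open>A threshold separating the two derivatives near \<open>b'\<close>:
      \<open>deriv g\<close> stays below it in norm and \<open>deriv (F n)\<close> exceeds it, so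
      their quotient has norm greater than 1.\<close>
    define L where "L = norm (deriv g b') + 1"
    have "isCont (deriv g) b'"
      using holomorphic_deriv[OF g(1) r(3)] r(3) b'V
      by (auto simp: continuous_on_eq_continuous_at dest!: holomorphic_on_imp_continuous_on)
    then have "((\<lambda>w. norm (deriv g w)) \<longlongrightarrow> norm (deriv g b')) (at b')"
      by (intro tendsto_norm) (simp add: isCont_def)
    then have evL: "\<forall>\<^sub>F w in at b'. norm (deriv g w) < L"
      by (rule order_tendstoD(2)) (simp add: L_def)
    have "is_pole (deriv (F n)) b'" using is_pole_deriv n by blast
    then have "filterlim (\<lambda>w. norm (deriv (F n) w)) at_top (at b')"
      unfolding is_pole_def by (rule filterlim_at_infinity_imp_norm_at_top)
    then have "\<forall>\<^sub>F w in at b'. L < norm (deriv (F n) w)" unfolding filterlim_at_top_dense by blast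
    with evL n(3) have "\<forall>\<^sub>F w in at b'. norm (deriv g w) < L \<and> L < norm (deriv (F n) w) \<and>
        iterate f n w = Some (F n w)"
      by eventually_elim blast
    then obtain N where N: "open N" "b' \<in> N"
      and Nw: "\<And>w. w \<in> N - {b'} \<Longrightarrow> norm (deriv g w) < L \<and> L < norm (deriv (F n) w) \<and>
        iterate f n w = Some (F n w)"
      unfolding eventually_at_topological by blast
    have N': "open (N \<inter> ?V \<inter> U)" "b' \<in> N \<inter> ?V \<inter> U" using N r(3) U(1) b'V b'(2) by auto
    have gan: "g analytic_on {b'}" using g(1) r(3) b'V analytic_at by blast
    then have "(g \<longlongrightarrow> g b') (at b')" using analytic_at_imp_isCont isCont_def by blast
    then have "filterlim (\<lambda>w. - g w + F n w) at_infinity (at b')"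
      using n(1) unfolding is_pole_def
      by (intro tendsto_add_filterlim_at_infinity[of _ "- g b'"] tendsto_minus)
    then have pole: "is_pole (\<lambda>w. F n w - g w) b'" by (simp add: is_pole_def)
    have iso: "isolated_singularity_at (\<lambda>w. F n w - g w) b'"
      using n(2) gan isolated_singularity_at_analytic by (intro singularity_intros) auto
    obtain R where R: "\<And>v. norm v > R \<Longrightarrow> \<exists>z\<in>N \<inter> ?V \<inter> U - {b'}. F n z - g z = v"
      using pole_covers_near_infinity[OF pole iso N'] by blast
    \<comment> \<open>Solving \<open>F n z = g z + w\<close> for a large period \<open>w\<close>
      gives \<open>f (F n z) = f (g z) = z\<close>, so \<open>z\<close> is fixed by the iterate of
      index \<open>n + 1\<close>.\<close>
    obtain w where w: "w \<in> periods f" "norm (0 + w) > R" using large_period by blast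
    then obtain z where z: "z \<in> N \<inter> ?V \<inter> U - {b'}" "F n z - g z = w" using R by force
    then obtain x where x: "x \<in> ball a r" "f x = z" by blast
    then have gz: "g z = x" using g(3) by blast
    have Fz: "F n z = x + w" using z(2) gz by (simp add: algebra_simps)
    have xB: "x \<in> ?B" using x(1) r(2) dsub by blast
    then have npx: "\<not> is_pole f x" using not_is_pole_holomorphic[OF open_ball _ \<delta>(2)] by blast
    then have npxw: "\<not> is_pole f (x + w)" using period_is_pole[OF w(1)] by simp
    have it: "iterate f n z = Some (x + w)" using Nw z(1) Fz by force
    have it1: "iterate f 1 (x + w) = Some z"
      using npx period_sphere_map[OF w(1), of x] x(2) by (simp add: sphere_map_def)
    have fixz: "iterate f (n + 1) z = Some z" using it it1 iterate_add[of n 1 z] by simp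
    have "\<forall>\<^sub>F u in nhds (x + w). \<not> is_pole f u"
      using eventually_not_pole[OF isolated, of "x + w"] npxw by (auto simp: eventually_nhds_conv_at)
    then have "\<forall>\<^sub>F u in nhds (x + w). F 1 u = f u"
      by eventually_elim (simp add: sphere_map_def)
    then have "deriv (F 1) (x + w) = deriv f (x + w)" by (rule deriv_cong_ev) simp
    then have "deriv (F (n + 1)) z = deriv f x * deriv (F n) z"
      using deriv_iterate_add[OF it it1] period_deriv[OF w(1)] by simp
    moreover have one: "deriv f x * deriv g z = 1" using g(2)[OF x(1)] x(2) by simp
    \<comment> \<open>The multiplier is \<open>deriv (F n) z / deriv g z\<close>, since
      \<open>deriv f x\<close> is the reciprocal of \<open>deriv g z\<close>.\<close>
    ultimately have "deriv (F n) z = deriv (F (n + 1)) z * deriv g z"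
      by (simp add: mult_ac)
    then have "norm (deriv (F n) z) = norm (deriv (F (n + 1)) z) * norm (deriv g z)"
      by (metis norm_mult)
    moreover have "norm (deriv g z) < norm (deriv (F n) z)" using Nw[of z] z(1) by auto
    moreover have "norm (deriv g z) > 0" using one by auto
    ultimately have "norm (deriv (F (n + 1)) z) > 1" by simp
    moreover have "iterate_defined f (n + 1) z"
      unfolding iterate_defined_def using fixz iterate_None_mono by fastforce
    ultimately have "z \<in> repelling_periodic_points f"
      using fixz unfolding repelling_periodic_points_def by (intro CollectI exI[of _ "n + 1"]) simp
    then show ?thesis using z(1) by blast
  qed
  then show "b \<in> closure (repelling_periodic_points f)"
    unfolding closure_iff_nhds_not_empty by blast
qed

text \<open>The inverse branch of \<open>F n\<close> at \<open>z\<close> is attracting and the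
  prepoles are invariant along it. Since the Julia set has no interior,
  \<open>porous_at_attracting_fixpoint\<close> applies.\<close>

lemma porous_at_repelling:
  assumes z: "z \<in> repelling_periodic_points f" and J: "J \<noteq> UNIV"
  shows "porous_at J z"
proof -
  obtain n where n: "iterate f n z = Some z" "norm (deriv (F n) z) > 1"
    using z by (auto simp: repelling_periodic_points_def)
  obtain U1 where U1: "open U1" "z \<in> U1" "\<And>w. w \<in> U1 \<Longrightarrow> iterate f n w = Some (F n w)"
    using iterate_finite(3)[OF n(1)] unfolding eventually_nhds by blast
  have "F n analytic_on {w}" if "w \<in> U1" for w using iterate_finite(1) U1(3)[OF that] by blast
  then have hol: "F n holomorphic_on U1"
    using analytic_imp_holomorphic analytic_on_analytic_at by blast
  have nz: "deriv (F n) z \<noteq> 0" using n(2) by auto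
  obtain r where r: "r > 0" "ball z r \<subseteq> U1" "open (F n ` ball z r)" "inj_on (F n) (ball z r)"
    using has_complex_derivative_locally_invertible[OF hol U1(2,1) nz] by blast
  have holr: "F n holomorphic_on ball z r" using hol r(2) holomorphic_on_subset by blast
  let ?T = "F n ` ball z r"
  obtain g where g: "g holomorphic_on ?T"
      "\<And>x. x \<in> ball z r \<Longrightarrow> deriv (F n) x * deriv g (F n x) = 1"
      "\<And>x. x \<in> ball z r \<Longrightarrow> g (F n x) = x"
    using holomorphic_has_inverse[OF holr open_ball r(4)] by blast
  have Fz: "F n z = z" using n(1) by simp
  have zr: "z \<in> ball z r" using r(1) by simp
  have zT: "z \<in> ?T" using imageI[OF zr, of "F n"] unfolding Fz .
  have gz: "g z = z" using g(3)[OF zr] Fz by simp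
  have "deriv (F n) z * deriv g z = 1" using g(2)[OF zr] Fz by simp
  then have "deriv g z = inverse (deriv (F n) z)" using nz by (simp add: field_simps)
  then have d: "norm (deriv g z) = inverse (norm (deriv (F n) z))" by (simp add: norm_inverse)
  \<comment> \<open>The invariant set is \<open>P\<close> rather than its closure, because
    invariance was established for prepoles pointwise.\<close>
  have "porous_at (closure P) z"
  proof (rule porous_at_attracting_fixpoint[OF g(1) r(3) zT gz])
    show "0 < norm (deriv g z)" "norm (deriv g z) < 1" using d n(2) by (auto simp: inverse_less_1_iff)
    fix w assume "w \<in> ?T" "g w \<in> P"
    then obtain x where x: "x \<in> ball z r" "w = F n x" by blast
    then have "iterate f n x = Some w" using U1(3) r(2) by blast
    moreover have "x \<in> P" using \<open>g w \<in> P\<close> g(3)[OF x(1)] x(2) by simp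
    ultimately show "w \<in> P" using iterate_mem_prepoles_iff by blast
  next
    fix U assume "open U" "z \<in> U"
    then show "\<not> U \<subseteq> closure P" using closure_prepoles_interior J julia_set_eq by auto
  qed
  then show ?thesis by (simp add: julia_set_eq)
qed

end

theorem theorem1p7:
  fixes f :: "complex \<Rightarrow> complex"
  assumes "elliptic f"
    and "\<not> sphere_map f constant_on UNIV"
  shows "(dense_subset_of {z \<in> julia_set f. \<not> porous_at (julia_set f) z} (julia_set f) \<and>
          prepoles f \<subseteq> {z \<in> julia_set f. \<not> porous_at (julia_set f) z}) \<and>
         (\<forall>b\<in>prepoles f. \<forall>\<kappa>\<in>{0<..<1}. \<exists>R>0. \<forall>r\<in>{0<..<R}. por (julia_set f) b r \<le> \<kappa>) \<and>
         (julia_set f \<noteq> UNIV \<longrightarrow>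
          dense_subset_of (repelling_periodic_points f) (julia_set f) \<and>
          (\<forall>z\<in>repelling_periodic_points f. porous_at (julia_set f) z))"
proof -
  interpret nonconst_elliptic f using assms by unfold_locales
  let ?N = "{z \<in> J. \<not> porous_at J z}"
  have sub: "P \<subseteq> ?N" using prepole_not_porous closure_subset[of P] by (auto simp: julia_set_eq)
  \<comment> \<open>The prepoles are dense in \<open>J\<close>, so any larger subset of
    \<open>J\<close> is dense too.\<close>
  then have "J \<subseteq> closure ?N" unfolding julia_set_eq by (rule closure_mono)
  then have "dense_subset_of ?N J" by (auto simp: dense_subset_of_def)
  moreover have "\<exists>R>0. \<forall>r\<in>{0<..<R}. por J b r \<le> \<kappa>" if "b \<in> P" "\<kappa> \<in> {0<..<1}" for b \<kappa>
    using por_julia_prepole_le[OF that(1), of \<kappa>] that(2) by (metis greaterThanLessThan_iff)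
  moreover have "dense_subset_of (repelling_periodic_points f) J"
    using repelling_in_closure_prepoles closure_minimal[OF prepoles_subset_closure_repelling closed_closure]
    by (auto simp: dense_subset_of_def julia_set_eq)
  ultimately show ?thesis using sub porous_at_repelling by blast
qed

end
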